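(* Given any finite constant specification $\mathsf{CS}$ for $\mathsf J$, and any sequent $\Gamma\Rightarrow\Delta$ in the language of $\mathsf{G3J}$, it is decidable whether the sequent is derivable in $\mathsf{G3J}_{\mathsf{CS}}$.
   Context: Logic $\mathsf J$. Terms are built from justification variables and constants by binary $\cdot,+$. Formulas are built from propositional variables and $\bot$ by $\neg,\wedge,\vee,\to$ and $t:A$ ($t$ a term). Axiom schemes: propositional tautologies; $s:A\to(s+t):A$, $s:A\to(t+s):A$; $s:(A\to B)\to(t:A\to(s\cdot t):B)$. A constant specification $\mathsf{CS}$ for $\mathsf J$ is a set of formulas $c_n:\dots:c_1:A$ ($n\ge1$, $c_j$ constants, $A$ an axiom instance), closed under passing from $c_n:c_{n-1}:\dots:c_1:A$ to $c_{n-1}:\dots:c_1:A$. Calculus $\mathsf{G3J}_{\mathsf{CS}}$. Fix a countably infinite set of labels $w,v,u,\dots$. The labeled language has labeled formulas $w\Vvdash A$, relational atoms $wRv$ and evidence atoms $wE(t,A)$ ($A$ a formula, $t$ a term). Sequents $\Gamma\Rightarrow\Delta$ consist of finite multisets of these. Initial sequents: $w\Vvdash P,\Gamma\Rightarrow\Delta,w\Vvdash P$ ($P$ a propositional variable); $w\Vvdash\bot,\Gamma\Rightarrow\Delta$; $wRv,\Gamma\Rightarrow\Delta,wRv$; $wE(t,A),\Gamma\Rightarrow\Delta,wE(t,A)$. Rules (premises / conclusion): (L$\neg$) $\Gamma\Rightarrow\Delta,w\Vvdash A$ / $w\Vvdash\neg A,\Gamma\Rightarrow\Delta$; (R$\neg$)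 $w\Vvdash A,\Gamma\Rightarrow\Delta$ / $\Gamma\Rightarrow\Delta,w\Vvdash\neg A$; (L$\wedge$) $w\Vvdash A,w\Vvdash B,\Gamma\Rightarrow\Delta$ / $w\Vvdash A\wedge B,\Gamma\Rightarrow\Delta$; (R$\wedge$) $\Gamma\Rightarrow\Delta,w\Vvdash A$ and $\Gamma\Rightarrow\Delta,w\Vvdash B$ / $\Gamma\Rightarrow\Delta,w\Vvdash A\wedge B$; (L$\vee$) $w\Vvdash A,\Gamma\Rightarrow\Delta$ and $w\Vvdash B,\Gamma\Rightarrow\Delta$ / $w\Vvdash A\vee B,\Gamma\Rightarrow\Delta$; (R$\vee$) $\Gamma\Rightarrow\Delta,w\Vvdash A,w\Vvdash B$ / $\Gamma\Rightarrow\Delta,w\Vvdash A\vee B$; (L$\to$) $\Gamma\Rightarrow\Delta,w\Vvdash A$ and $w\Vvdash B,\Gamma\Rightarrow\Delta$ / $w\Vvdash A\to B,\Gamma\Rightarrow\Delta$; (R$\to$) $w\Vvdash A,\Gamma\Rightarrow\Delta,w\Vvdash B$ / $\Gamma\Rightarrow\Delta,w\Vvdash A\to B$; (L:) $v\Vvdash A,w\Vvdash t:A,wRv,\Gamma\Rightarrow\Delta$ / $w\Vvdash t:A,wRv,\Gamma\Rightarrow\Delta$; (R:) $wRv,wE(t,A),\Gamma\Rightarrow\Delta,v\Vvdash A$ / $wE(t,A),\Gamma\Rightarrow\Delta,w\Vvdash t:A$, where $v$ does not occur in the conclusion; (E) $wE(t,A),w\Vvdash t:A,\Gamma\Rightarrow\Delta$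 / $w\Vvdash t:A,\Gamma\Rightarrow\Delta$; (El+) $wE(s+t,A),wE(t,A),\Gamma\Rightarrow\Delta$ / $wE(t,A),\Gamma\Rightarrow\Delta$; (Er+) $wE(t+s,A),wE(t,A),\Gamma\Rightarrow\Delta$ / $wE(t,A),\Gamma\Rightarrow\Delta$; (E$\cdot$) $wE(s\cdot t,B),wE(s,A\to B),wE(t,A),\Gamma\Rightarrow\Delta$ / $wE(s,A\to B),wE(t,A),\Gamma\Rightarrow\Delta$; (IAN) $wE(c,F),\Gamma\Rightarrow\Delta$ / $\Gamma\Rightarrow\Delta$, for $c:F\in\mathsf{CS}$ ($c$ a constant). *)

theory Defs
  imports Main "HOL-Library.Multiset" "HOL-Library.Nat_Bijection"
begin

section \<open>The logic J\<close>

text \<open>Justification variables, justification constants, propositional variables and labels are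
  each a countably infinite supply, indexed by natural numbers.\<close>

datatype tm = JVar nat | JConst nat | App tm tm | Plus tm tm

datatype fm =
    Prop nat
  | Bot
  | Neg fm
  | Conj fm fm
  | Disj fm fm
  | Imp fm fm
  | Just tm fm  \<comment> \<open>\<open>t : A\<close>\<close>

text \<open>Propositional tautologies in the full language: propositional variables and all formulas
  \<open>t : A\<close> are treated as atoms.\<close>

primrec holds :: "(nat \<Rightarrow> bool) \<Rightarrow> (tm \<Rightarrow> fm \<Rightarrow> bool) \<Rightarrow> fm \<Rightarrow> bool" where
  "holds p j (Prop n) \<longleftrightarrow> p n"
| "holds p j Bot \<longleftrightarrow> False"
| "holds p j (Neg A) \<longleftrightarrow> \<not> holds p j A"
| "holds p j (Conj A B) \<longleftrightarrow> holds p j A \<and> holds p j B"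
| "holds p j (Disj A B) \<longleftrightarrow> holds p j A \<or> holds p j B"
| "holds p j (Imp A B) \<longleftrightarrow> (holds p j A \<longrightarrow> holds p j B)"
| "holds p j (Just t A) \<longleftrightarrow> j t A"

definition tautology :: "fm \<Rightarrow> bool" where
  "tautology A \<longleftrightarrow> (\<forall>p j. holds p j A)"

inductive J_axiom :: "fm \<Rightarrow> bool" where
  taut: "tautology A \<Longrightarrow> J_axiom A"
| sum_left: "J_axiom (Imp (Just s A) (Just (Plus s t) A))"
| sum_right: "J_axiom (Imp (Just s A) (Just (Plus t s) A))"
| app: "J_axiom (Imp (Just s (Imp A B)) (Imp (Just t A) (Just (App s t) B)))"

text \<open>\<open>const_prefix [c\<^sub>n, \<dots>, c\<^sub>1] A\<close> is the formula \<open>c\<^sub>n : \<dots> : c\<^sub>1 : A\<close>.\<close>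

definition const_prefix :: "nat list \<Rightarrow> fm \<Rightarrow> fm" where
  "const_prefix cs A = foldr (\<lambda>c F. Just (JConst c) F) cs A"

definition constant_specification :: "fm set \<Rightarrow> bool" where
  "constant_specification CS \<longleftrightarrow>
     (\<forall>F \<in> CS. \<exists>cs A. cs \<noteq> [] \<and> J_axiom A \<and> F = const_prefix cs A) \<and>
     (\<forall>c cs A. cs \<noteq> [] \<longrightarrow> J_axiom A \<longrightarrow>
        const_prefix (c # cs) A \<in> CS \<longrightarrow> const_prefix cs A \<in> CS)"


section \<open>The labeled sequent calculus\<close>

datatype item =
    Forces nat fm  \<comment> \<open>labeled formula\<close>
  | Rel nat nat  \<comment> \<open>relational atom \<open>w R v\<close>\<close>
  | Evid nat tm fm  \<comment> \<open>evidence atom \<open>w E (t, A)\<close>\<close>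

primrec labels :: "item \<Rightarrow> nat set" where
  "labels (Forces w A) = {w}"
| "labels (Rel w v) = {w, v}"
| "labels (Evid w t A) = {w}"

definition mset_labels :: "item multiset \<Rightarrow> nat set" where
  "mset_labels \<Gamma> = (\<Union>x \<in> set_mset \<Gamma>. labels x)"

type_synonym sequent = "item multiset \<times> item multiset"

inductive G3J :: "fm set \<Rightarrow> item multiset \<Rightarrow> item multiset \<Rightarrow> bool" for CS where
  Ax_prop: "G3J CS (add_mset (Forces w (Prop P)) \<Gamma>) (add_mset (Forces w (Prop P)) \<Delta>)"
| Ax_bot: "G3J CS (add_mset (Forces w Bot) \<Gamma>) \<Delta>"
| Ax_rel: "G3J CS (add_mset (Rel w v) \<Gamma>) (add_mset (Rel w v) \<Delta>)"
| Ax_evid: "G3J CS (add_mset (Evid w t A) \<Gamma>) (add_mset (Evid w t A) \<Delta>)"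
| L_neg: "G3J CS \<Gamma> (add_mset (Forces w A) \<Delta>)
    \<Longrightarrow> G3J CS (add_mset (Forces w (Neg A)) \<Gamma>) \<Delta>"
| R_neg: "G3J CS (add_mset (Forces w A) \<Gamma>) \<Delta>
    \<Longrightarrow> G3J CS \<Gamma> (add_mset (Forces w (Neg A)) \<Delta>)"
| L_conj: "G3J CS (add_mset (Forces w A) (add_mset (Forces w B) \<Gamma>)) \<Delta>
    \<Longrightarrow> G3J CS (add_mset (Forces w (Conj A B)) \<Gamma>) \<Delta>"
| R_conj: "G3J CS \<Gamma> (add_mset (Forces w A) \<Delta>)
    \<Longrightarrow> G3J CS \<Gamma> (add_mset (Forces w B) \<Delta>)
    \<Longrightarrow> G3J CS \<Gamma> (add_mset (Forces w (Conj A B)) \<Delta>)"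
| L_disj: "G3J CS (add_mset (Forces w A) \<Gamma>) \<Delta>
    \<Longrightarrow> G3J CS (add_mset (Forces w B) \<Gamma>) \<Delta>
    \<Longrightarrow> G3J CS (add_mset (Forces w (Disj A B)) \<Gamma>) \<Delta>"
| R_disj: "G3J CS \<Gamma> (add_mset (Forces w A) (add_mset (Forces w B) \<Delta>))
    \<Longrightarrow> G3J CS \<Gamma> (add_mset (Forces w (Disj A B)) \<Delta>)"
| L_imp: "G3J CS \<Gamma> (add_mset (Forces w A) \<Delta>)
    \<Longrightarrow> G3J CS (add_mset (Forces w B) \<Gamma>) \<Delta>
    \<Longrightarrow> G3J CS (add_mset (Forces w (Imp A B)) \<Gamma>) \<Delta>"
| R_imp: "G3J CS (add_mset (Forces w A) \<Gamma>) (add_mset (Forces w B) \<Delta>)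
    \<Longrightarrow> G3J CS \<Gamma> (add_mset (Forces w (Imp A B)) \<Delta>)"
| L_just: "G3J CS (add_mset (Forces v A) (add_mset (Forces w (Just t A)) (add_mset (Rel w v) \<Gamma>))) \<Delta>
    \<Longrightarrow> G3J CS (add_mset (Forces w (Just t A)) (add_mset (Rel w v) \<Gamma>)) \<Delta>"
| R_just: "G3J CS (add_mset (Rel w v) (add_mset (Evid w t A) \<Gamma>)) (add_mset (Forces v A) \<Delta>)
    \<Longrightarrow> v \<notin> mset_labels (add_mset (Evid w t A) \<Gamma>)
    \<Longrightarrow> v \<notin> mset_labels (add_mset (Forces w (Just t A)) \<Delta>)
    \<Longrightarrow> G3J CS (add_mset (Evid w t A) \<Gamma>) (add_mset (Forces w (Just t A)) \<Delta>)"
| E: "G3J CS (add_mset (Evid w t A) (add_mset (Forces w (Just t A)) \<Gamma>)) \<Delta>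
    \<Longrightarrow> G3J CS (add_mset (Forces w (Just t A)) \<Gamma>) \<Delta>"
| El_plus: "G3J CS (add_mset (Evid w (Plus s t) A) (add_mset (Evid w t A) \<Gamma>)) \<Delta>
    \<Longrightarrow> G3J CS (add_mset (Evid w t A) \<Gamma>) \<Delta>"
| Er_plus: "G3J CS (add_mset (Evid w (Plus t s) A) (add_mset (Evid w t A) \<Gamma>)) \<Delta>
    \<Longrightarrow> G3J CS (add_mset (Evid w t A) \<Gamma>) \<Delta>"
| E_app: "G3J CS (add_mset (Evid w (App s t) B)
              (add_mset (Evid w s (Imp A B)) (add_mset (Evid w t A) \<Gamma>))) \<Delta>
    \<Longrightarrow> G3J CS (add_mset (Evid w s (Imp A B)) (add_mset (Evid w t A) \<Gamma>)) \<Delta>"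
| IAN: "G3J CS (add_mset (Evid w (JConst c) F) \<Gamma>) \<Delta>
    \<Longrightarrow> Just (JConst c) F \<in> CS
    \<Longrightarrow> G3J CS \<Gamma> \<Delta>"


section \<open>Decidability\<close>

text \<open>Total recursive (computable) functions: the closure of the basic functions under
  composition, primitive recursion and minimization of regular functions.
  \<open>recursive_fn n f\<close> says that \<open>f\<close>, restricted to argument lists of length \<open>n\<close>, is a total
  recursive \<open>n\<close>-ary function; the values of \<open>f\<close> on lists of other lengths are irrelevant.\<close>

inductive recursive_fn :: "nat \<Rightarrow> (nat list \<Rightarrow> nat) \<Rightarrow> bool" where
  zero: "recursive_fn n (\<lambda>xs. 0)"
| succ: "recursive_fn 1 (\<lambda>xs. Suc (xs ! 0))"
| proj: "i < n \<Longrightarrow> recursive_fn n (\<lambda>xs. xs ! i)"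
| comp: "recursive_fn (length gs) f \<Longrightarrow> (\<forall>g \<in> set gs. recursive_fn n g)
    \<Longrightarrow> recursive_fn n (\<lambda>xs. f (map (\<lambda>g. g xs) gs))"
| prim_rec: "recursive_fn n f \<Longrightarrow> recursive_fn (Suc (Suc n)) g
    \<Longrightarrow> recursive_fn (Suc n)
          (\<lambda>xs. rec_nat (f (tl xs)) (\<lambda>y r. g (y # r # tl xs)) (hd xs))"
| minimize: "recursive_fn (Suc n) f \<Longrightarrow> (\<forall>xs. length xs = n \<longrightarrow> (\<exists>y. f (y # xs) = 0))
    \<Longrightarrow> recursive_fn n (\<lambda>xs. LEAST y. f (y # xs) = 0)"
| ext: "recursive_fn n f \<Longrightarrow> (\<forall>xs. length xs = n \<longrightarrow> g xs = f xs) \<Longrightarrow> recursive_fn n g"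

text \<open>The decision problem with instances \<open>I\<close>, presented to the algorithm through the coding
  \<open>code\<close>, and yes-instances \<open>{x \<in> I. P x}\<close> has a total recursive decision function. This is
  meaningful only for an effective coding that is injective on \<open>I\<close>.\<close>

definition decidable_problem :: "('a \<Rightarrow> nat) \<Rightarrow> 'a set \<Rightarrow> ('a \<Rightarrow> bool) \<Rightarrow> bool" where
  "decidable_problem code I P \<longleftrightarrow>
     (\<exists>f. recursive_fn 1 f \<and> (\<forall>x \<in> I. f [code x] = (if P x then 1 else 0)))"

primrec tm_code :: "tm \<Rightarrow> nat" where
  "tm_code (JVar n) = prod_encode (0, n)"
| "tm_code (JConst n) = prod_encode (1, n)"
| "tm_code (App s t) = prod_encode (2, prod_encode (tm_code s, tm_code t))"
| "tm_code (Plus s t) = prod_encode (3, prod_encode (tm_code s, tm_code t))"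

primrec fm_code :: "fm \<Rightarrow> nat" where
  "fm_code (Prop n) = prod_encode (0, n)"
| "fm_code Bot = prod_encode (1, 0)"
| "fm_code (Neg A) = prod_encode (2, fm_code A)"
| "fm_code (Conj A B) = prod_encode (3, prod_encode (fm_code A, fm_code B))"
| "fm_code (Disj A B) = prod_encode (4, prod_encode (fm_code A, fm_code B))"
| "fm_code (Imp A B) = prod_encode (5, prod_encode (fm_code A, fm_code B))"
| "fm_code (Just t A) = prod_encode (6, prod_encode (tm_code t, fm_code A))"

primrec item_code :: "item \<Rightarrow> nat" where
  "item_code (Forces w A) = prod_encode (0, prod_encode (w, fm_code A))"
| "item_code (Rel w v) = prod_encode (1, prod_encode (w, v))"
| "item_code (Evid w t A) =
     prod_encode (2, prod_encode (w, prod_encode (tm_code t, fm_code A)))"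

text \<open>Finite multisets of items and finite sets of formulas are coded by the sorted list of the
  codes of their elements.\<close>

definition mset_code :: "item multiset \<Rightarrow> nat" where
  "mset_code \<Gamma> = list_encode (sorted_list_of_multiset (image_mset item_code \<Gamma>))"

definition fmset_code :: "fm set \<Rightarrow> nat" where
  "fmset_code CS = list_encode (sorted_list_of_set (fm_code ` CS))"

definition sequent_code :: "sequent \<Rightarrow> nat" where
  "sequent_code S = prod_encode (mset_code (fst S), mset_code (snd S))"

definition instance_code :: "fm set \<times> sequent \<Rightarrow> nat" where
  "instance_code x = prod_encode (fmset_code (fst x), sequent_code (snd x))"

lemma tm_code_eq_iff: "tm_code s = tm_code t \<longleftrightarrow> s = t"
proof (induction s arbitrary: t)
  case (JVar n) show ?case by (cases t) auto
next
  case (JConst n) show ?case by (cases t) auto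
next
  case (App s1 s2) then show ?case by (cases t) auto
next
  case (Plus s1 s2) then show ?case by (cases t) auto
qed

lemma fm_code_eq_iff: "fm_code A = fm_code B \<longleftrightarrow> A = B"
proof (induction A arbitrary: B)
  case (Prop n) show ?case by (cases B) auto
next
  case Bot show ?case by (cases B) auto
next
  case (Neg A) then show ?case by (cases B) auto
next
  case (Conj A1 A2) then show ?case by (cases B) auto
next
  case (Disj A1 A2) then show ?case by (cases B) auto
next
  case (Imp A1 A2) then show ?case by (cases B) auto
next
  case (Just t A) then show ?case by (cases B) (auto simp: tm_code_eq_iff)
qed

lemma item_code_eq_iff: "item_code x = item_code y \<longleftrightarrow> x = y"
  by (cases x; cases y) (auto simp: tm_code_eq_iff fm_code_eq_iff)

lemma mset_code_eq_iff: "mset_code \<Gamma> = mset_code \<Delta> \<longleftrightarrow> \<Gamma> = \<Delta>"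
proof
  assume "mset_code \<Gamma> = mset_code \<Delta>"
  then have "image_mset item_code \<Gamma> = image_mset item_code \<Delta>"
    unfolding mset_code_def list_encode_eq by (metis mset_sorted_list_of_multiset)
  moreover have "inj item_code"
    by (simp add: inj_def item_code_eq_iff)
  ultimately show "\<Gamma> = \<Delta>"
    by (metis multiset.inj_map injD)
qed simp

lemma fmset_code_eq_iff:
  assumes "finite X" "finite Y"
  shows "fmset_code X = fmset_code Y \<longleftrightarrow> X = Y"
proof
  assume "fmset_code X = fmset_code Y"
  then have "fm_code ` X = fm_code ` Y"
    unfolding fmset_code_def list_encode_eq
    by (metis assms finite_imageI set_sorted_list_of_set)
  then show "X = Y"
    by (metis fm_code_eq_iff injI inj_image_eq_iff)
qed simp

lemma instance_code_inj: "inj_on instance_code {(CS, S). finite CS}"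
  by (auto simp: inj_on_def instance_code_def sequent_code_def mset_code_eq_iff
      fmset_code_eq_iff)

end

theory Submission imports Defs begin

text \<open>An underivable sequent is contained in a pair \<open>(L, R)\<close> of item sets saturated under all rules
  read backwards, and such a pair yields a countermodel. The pair can be kept finite: evidence
  matters only for terms that occur on the right, so terms and formulas are bounded by the code of
  the instance, and a label created by the right rule for \<open>t : A\<close> carries formulas of smaller modal
  depth than its parent and is determined by the parent and \<open>A\<close>, which bounds the labels as well.
  Coding \<open>L\<close> and \<open>R\<close> by bit sets turns underivability into an arithmetical condition in
  which all quantifiers are bounded by primitive recursive functions.\<close>

text \<open>Backward search need not terminate: the sum rules add ever larger terms, and
  \<open>IAN\<close> adds evidence at any label. The way out is an asymmetry. The countermodel
  carries the least evidence relation generated by all evidence rules, whereas \<open>L\<close> only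
  has to be closed inside \<open>T\<close>. At labels with a labeled formula or an evidence atom on
  the right the two agree on \<open>T\<close>, since evidence for a term is generated only from
  evidence for its subterms. Modal depth alone does not bound the labels, because relational atoms
  of the end sequent may form cycles. Depth is therefore charged only against generations of created
  labels, while formulas at original labels are bounded by their codes. No search strategy or
  fairness argument occurs: finitely many items are admissible, so a state with the largest possible
  sets exists, and every rule that still had something to add would enlarge it.\<close>

section \<open>Refutation by saturated sets\<close>

text \<open>\<open>T\<close> is a set of terms closed under subterms that contains all terms to be matched in \<open>R\<close>;
  evidence in \<open>L\<close> only has to be closed with respect to terms in \<open>T\<close>.\<close>

locale hintikka =
  fixes CS :: "fm set" and T :: "tm set" and L R :: "item set"
  assumes consistent_Prop: "\<not> (Forces w (Prop P) \<in> L \<and> Forces w (Prop P) \<in> R)"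
    and consistent_Bot: "Forces w Bot \<notin> L"
    and consistent_Rel: "\<not> (Rel w v \<in> L \<and> Rel w v \<in> R)"
    and consistent_Evid: "\<not> (Evid w t A \<in> L \<and> Evid w t A \<in> R)"
    and left_Neg: "Forces w (Neg A) \<in> L \<Longrightarrow> Forces w A \<in> R"
    and right_Neg: "Forces w (Neg A) \<in> R \<Longrightarrow> Forces w A \<in> L"
    and left_Conj: "Forces w (Conj A B) \<in> L \<Longrightarrow> Forces w A \<in> L \<and> Forces w B \<in> L"
    and right_Conj: "Forces w (Conj A B) \<in> R \<Longrightarrow> Forces w A \<in> R \<or> Forces w B \<in> R"
    and left_Disj: "Forces w (Disj A B) \<in> L \<Longrightarrow> Forces w A \<in> L \<or> Forces w B \<in> L"
    and right_Disj: "Forces w (Disj A B) \<in> R \<Longrightarrow> Forces w A \<in> R \<and> Forces w B \<in> R"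
    and left_Imp: "Forces w (Imp A B) \<in> L \<Longrightarrow> Forces w A \<in> R \<or> Forces w B \<in> L"
    and right_Imp: "Forces w (Imp A B) \<in> R \<Longrightarrow> Forces w A \<in> L \<and> Forces w B \<in> R"
    and left_Just: "Forces w (Just t A) \<in> L \<Longrightarrow> Rel w v \<in> L \<Longrightarrow> Forces v A \<in> L"
    and right_Just: "Forces w (Just t A) \<in> R \<Longrightarrow> Evid w t A \<in> L \<Longrightarrow>
      \<exists>v. Rel w v \<in> L \<and> Forces v A \<in> R"
    and left_Just_Evid: "Forces w (Just t A) \<in> L \<Longrightarrow> Evid w t A \<in> L"
    and Evid_Plus_right: "Evid w t A \<in> L \<Longrightarrow> Plus s t \<in> T \<Longrightarrow> Evid w (Plus s t) A \<in> L"
    and Evid_Plus_left: "Evid w t A \<in> L \<Longrightarrow> Plus t s \<in> T \<Longrightarrow> Evid w (Plus t s) A \<in> L"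
    and Evid_App: "Evid w s (Imp A B) \<in> L \<Longrightarrow> Evid w t A \<in> L \<Longrightarrow> App s t \<in> T \<Longrightarrow>
      Evid w (App s t) B \<in> L"
    and Evid_const_Forces: "Forces w A \<in> R \<Longrightarrow> Just (JConst c) F \<in> CS \<Longrightarrow>
      Evid w (JConst c) F \<in> L"
    and Evid_const_Evid: "Evid w t A \<in> R \<Longrightarrow> Just (JConst c) F \<in> CS \<Longrightarrow>
      Evid w (JConst c) F \<in> L"
    and terms_Forces: "Forces w (Just t A) \<in> R \<Longrightarrow> t \<in> T"
    and terms_Evid: "Evid w t A \<in> R \<Longrightarrow> t \<in> T"
    and terms_Plus: "Plus s t \<in> T \<Longrightarrow> s \<in> T \<and> t \<in> T"
    and terms_App: "App s t \<in> T \<Longrightarrow> s \<in> T \<and> t \<in> T"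

text \<open>Closure under all evidence rules is what soundness requires. \<open>L\<close> itself
  would not do as the evidence of the model, since the rules also build terms outside
  \<open>T\<close>.\<close>

inductive evidence :: "fm set \<Rightarrow> item set \<Rightarrow> nat \<Rightarrow> tm \<Rightarrow> fm \<Rightarrow> bool" for CS L where
  base: "Evid w t A \<in> L \<Longrightarrow> evidence CS L w t A"
| const: "Just (JConst c) F \<in> CS \<Longrightarrow> evidence CS L w (JConst c) F"
| plus_right: "evidence CS L w t A \<Longrightarrow> evidence CS L w (Plus s t) A"
| plus_left: "evidence CS L w t A \<Longrightarrow> evidence CS L w (Plus t s) A"
| app: "evidence CS L w s (Imp A B) \<Longrightarrow> evidence CS L w t A \<Longrightarrow> evidence CS L w (App s t) B"

text \<open>This is a Fitting model: the worlds are the natural numbers, accessibility is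
  \<open>Rel\<close> in \<open>L\<close>, and \<open>t : A\<close> demands both evidence and truth
  at all accessible worlds.\<close>

primrec true_at :: "fm set \<Rightarrow> item set \<Rightarrow> nat \<Rightarrow> fm \<Rightarrow> bool" where
  "true_at CS L w (Prop P) \<longleftrightarrow> Forces w (Prop P) \<in> L"
| "true_at CS L w Bot \<longleftrightarrow> False"
| "true_at CS L w (Neg A) \<longleftrightarrow> \<not> true_at CS L w A"
| "true_at CS L w (Conj A B) \<longleftrightarrow> true_at CS L w A \<and> true_at CS L w B"
| "true_at CS L w (Disj A B) \<longleftrightarrow> true_at CS L w A \<or> true_at CS L w B"
| "true_at CS L w (Imp A B) \<longleftrightarrow> (true_at CS L w A \<longrightarrow> true_at CS L w B)"
| "true_at CS L w (Just t A) \<longleftrightarrow>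
     evidence CS L w t A \<and> (\<forall>v. Rel w v \<in> L \<longrightarrow> true_at CS L v A)"

text \<open>The assignment separates labels from worlds, so that the fresh label of the right rule
  for \<open>t : A\<close> can denote an arbitrary accessible world.\<close>

primrec true_item :: "fm set \<Rightarrow> item set \<Rightarrow> (nat \<Rightarrow> nat) \<Rightarrow> item \<Rightarrow> bool" where
  "true_item CS L \<rho> (Forces w A) \<longleftrightarrow> true_at CS L (\<rho> w) A"
| "true_item CS L \<rho> (Rel w v) \<longleftrightarrow> Rel (\<rho> w) (\<rho> v) \<in> L"
| "true_item CS L \<rho> (Evid w t A) \<longleftrightarrow> evidence CS L (\<rho> w) t A"

lemma true_item_fun_upd:
  "v \<notin> labels x \<Longrightarrow> true_item CS L (\<rho>(v := u)) x = true_item CS L \<rho> x"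
  by (cases x) auto

lemma true_item_fun_upd_mset:
  "v \<notin> mset_labels \<Gamma> \<Longrightarrow> x \<in># \<Gamma> \<Longrightarrow> true_item CS L (\<rho>(v := u)) x = true_item CS L \<rho> x"
  by (auto simp: mset_labels_def true_item_fun_upd)

lemma G3J_sound:
  assumes "G3J CS \<Gamma> \<Delta>" and "\<forall>x\<in>#\<Gamma>. true_item CS L \<rho> x"
  shows "\<exists>x\<in>#\<Delta>. true_item CS L \<rho> x"
  using assms
proof (induction arbitrary: \<rho> rule: G3J.induct)
  case (R_just w v t A \<Gamma> \<Delta>)
  show ?case
  proof (cases "\<exists>x\<in>#\<Delta>. true_item CS L \<rho> x")
    case False
    \<comment> \<open>Sending the fresh label to \<open>u\<close> leaves the truth of the context
      unchanged, so with all of \<open>\<Delta>\<close> false the premise can only make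
      \<open>A\<close> true at \<open>u\<close>.\<close>
    have "true_at CS L u A" if u: "Rel (\<rho> w) u \<in> L" for u
    proof -
      let ?\<rho> = "\<rho>(v := u)"
      have w: "w \<noteq> v" using R_just.hyps(2) by (auto simp: mset_labels_def)
      have "v \<notin> mset_labels \<Gamma>" "v \<notin> mset_labels \<Delta>"
        using R_just.hyps(2,3) by (auto simp: mset_labels_def)
      note upd = this[THEN true_item_fun_upd_mset]
      have "\<forall>x\<in>#add_mset (Rel w v) (add_mset (Evid w t A) \<Gamma>). true_item CS L ?\<rho> x"
        using R_just.prems u w upd(1) by auto
      from R_just.IH[OF this] obtain x where "x = Forces v A \<or> x \<in># \<Delta>" "true_item CS L ?\<rho> x"
        by (metis insert_iff set_mset_add_mset_insert)
      then show ?thesis using False upd(2) by (metis fun_upd_same true_item.simps(1))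
    qed
    then show ?thesis using R_just.prems by simp
  qed auto
next
  case (El_plus w s t A \<Gamma> \<Delta>)
  then show ?case by (simp add: evidence.plus_right)
next
  case (Er_plus w t s A \<Gamma> \<Delta>)
  then show ?case by (simp add: evidence.plus_left)
next
  case (E_app w s t B A \<Gamma> \<Delta>)
  then have "evidence CS L (\<rho> w) (App s t) B" by (auto intro: evidence.app)
  then show ?case using E_app by simp
next
  case (IAN w c F \<Gamma> \<Delta>)
  then show ?case by (simp add: evidence.const)
qed (simp; blast)+

context hintikka
begin

text \<open>Only at these labels does missing evidence have to be certified, so only there must
  \<open>L\<close> contain the evidence for constants. Demanding it at every natural number could
  make \<open>L\<close> infinite.\<close>

definition active :: "nat \<Rightarrow> bool" where
  "active w \<longleftrightarrow> (\<exists>A. Forces w A \<in> R) \<or> (\<exists>t A. Evid w t A \<in> R)"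

text \<open>Each clause builds a term from its immediate subterms, and \<open>T\<close> is closed
  under subterms, so a generation that ends in \<open>T\<close> never leaves
  \<open>T\<close>.\<close>

lemma evidence_in_left:
  "evidence C L w t A \<Longrightarrow> C \<subseteq> CS \<Longrightarrow> t \<in> T \<Longrightarrow> active w \<Longrightarrow> Evid w t A \<in> L"
proof (induction rule: evidence.induct)
  case (const c F w)
  then have "Just (JConst c) F \<in> CS" by blast
  then show ?case
    using const.prems(3) Evid_const_Forces Evid_const_Evid unfolding active_def by blast
next
  case (plus_right w t A s)
  then show ?case using terms_Plus Evid_Plus_right by blast
next
  case (plus_left w t A s)
  then show ?case using terms_Plus Evid_Plus_left by blast
next
  case (app w s A B t)
  then show ?case using terms_App Evid_App by blast
qed

text \<open>On the right, \<open>t : A\<close> fails either for lack of evidence or at the world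
  supplied by \<open>right_Just\<close>. A smaller \<open>C\<close> only removes generated evidence;
  this slack is used later, when a guessed code may describe more than the given
  specification.\<close>

lemma truth:
  assumes C: "C \<subseteq> CS"
  shows "(Forces w A \<in> L \<longrightarrow> true_at C L w A) \<and> (Forces w A \<in> R \<longrightarrow> \<not> true_at C L w A)"
proof (induction A arbitrary: w)
  case (Just t A)
  have "true_at C L w (Just t A)" if "Forces w (Just t A) \<in> L"
    using that left_Just left_Just_Evid Just.IH by (simp add: evidence.base)
  moreover have "\<not> true_at C L w (Just t A)" if R: "Forces w (Just t A) \<in> R"
  proof
    assume true: "true_at C L w (Just t A)"
    moreover have "active w" using R unfolding active_def by blast
    ultimately have "Evid w t A \<in> L"
      using evidence_in_left[OF _ C terms_Forces[OF R]] by simp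
    then obtain v where "Rel w v \<in> L" "Forces v A \<in> R"
      using right_Just[OF R] by blast
    then show False using true Just.IH by (metis true_at.simps(7))
  qed
  ultimately show ?case by blast
next
  case (Prop P)
  then show ?case using consistent_Prop by (simp; blast)
next
  case Bot
  then show ?case using consistent_Bot by simp
next
  case (Neg A)
  then show ?case using left_Neg right_Neg by simp
next
  case (Conj A B)
  then show ?case using left_Conj right_Conj true_at.simps(4) by metis
next
  case (Disj A B)
  then show ?case using left_Disj right_Disj true_at.simps(5) by metis
next
  case (Imp A B)
  then show ?case using left_Imp right_Imp true_at.simps(6) by metis
qed

lemma not_derivable:
  assumes C: "C \<subseteq> CS" and sub: "set_mset \<Gamma> \<subseteq> L" "set_mset \<Delta> \<subseteq> R"
  shows "\<not> G3J C \<Gamma> \<Delta>"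
proof
  assume d: "G3J C \<Gamma> \<Delta>"
  have "true_item C L id x" if "x \<in> L" for x
    using that truth[OF C] by (cases x) (simp_all add: evidence.base)
  then obtain x where x: "x \<in> R" "true_item C L id x"
    using G3J_sound[OF d, of L id] sub by blast
  show False
  proof (cases x)
    case (Forces w A)
    then show ?thesis using x truth[OF C] by simp
  next
    case (Rel w v)
    then show ?thesis using x consistent_Rel by simp
  next
    case (Evid w t A)
    moreover have "active w" using Evid x(1) unfolding active_def by blast
    ultimately have "Evid w t A \<in> L"
      using evidence_in_left[OF _ C] terms_Evid x by simp
    then show ?thesis using Evid x(1) consistent_Evid by simp
  qed
qed

end

section \<open>Saturation of underivable sequents\<close>

lemma prod_encode_mono: "a \<le> c \<Longrightarrow> b \<le> d \<Longrightarrow> prod_encode (a, b) \<le> prod_encode (c, d)"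
proof -
  have tri: "triangle m \<le> triangle n" if "m \<le> n" for m n
    using that by (induction rule: dec_induct) auto
  show "a \<le> c \<Longrightarrow> b \<le> d \<Longrightarrow> prod_encode (a, b) \<le> prod_encode (c, d)"
    unfolding prod_encode_def using tri[of "a + b" "c + d"] by simp
qed

lemma add_le_prod_encode: "a + b \<le> prod_encode (a, b)"
proof -
  have "m \<le> triangle m" for m by (induction m) auto
  from this[of "a + b"] show ?thesis unfolding prod_encode_def by simp
qed

primrec jdepth :: "fm \<Rightarrow> nat" where
  "jdepth (Prop n) = 0"
| "jdepth Bot = 0"
| "jdepth (Neg A) = jdepth A"
| "jdepth (Conj A B) = max (jdepth A) (jdepth B)"
| "jdepth (Disj A B) = max (jdepth A) (jdepth B)"
| "jdepth (Imp A B) = max (jdepth A) (jdepth B)"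
| "jdepth (Just t A) = Suc (jdepth A)"

lemma prod_encode_leD:
  assumes "prod_encode (a, b) \<le> n" shows "a \<le> n" "b \<le> n"
  using assms le_prod_encode_1[of a b] le_prod_encode_2[of b a] by linarith+

lemma prod_encode_lessD:
  assumes "prod_encode (a, b) < n" shows "a < n" "b < n"
  using assms le_prod_encode_1[of a b] le_prod_encode_2[of b a] by linarith+

lemma prod_encode_le_conjD: "prod_encode (a, b) \<le> n \<Longrightarrow> a \<le> n \<and> b \<le> n"
  using prod_encode_leD by blast

lemma jdepth_le_fm_code: "jdepth A \<le> fm_code A"
proof (induction A)
  case (Conj A B)
  then show ?case
    using prod_encode_leD[of 3 "prod_encode (fm_code A, fm_code B)" "fm_code (Conj A B)"]
      prod_encode_leD[of "fm_code A" "fm_code B" "fm_code (Conj A B)"] by simp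
next
  case (Disj A B)
  then show ?case
    using prod_encode_leD[of 4 "prod_encode (fm_code A, fm_code B)" "fm_code (Disj A B)"]
      prod_encode_leD[of "fm_code A" "fm_code B" "fm_code (Disj A B)"] by simp
next
  case (Imp A B)
  then show ?case
    using prod_encode_leD[of 5 "prod_encode (fm_code A, fm_code B)" "fm_code (Imp A B)"]
      prod_encode_leD[of "fm_code A" "fm_code B" "fm_code (Imp A B)"] by simp
next
  case (Neg A)
  then show ?case using prod_encode_leD(2)[of 2 "fm_code A"] by force
next
  case (Just t A)
  \<comment> \<open>The constructor tag 6 is added to the code of the components, which pays for the
    successor in \<open>jdepth\<close>.\<close>
  then show ?case
    using add_le_prod_encode[of 6 "prod_encode (tm_code t, fm_code A)"]
      le_prod_encode_2[of "fm_code A" "tm_code t"] by simp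
qed simp_all

text \<open>The label created by the right rule for \<open>w : t : A\<close> is named after \<open>w\<close> and the code of
  \<open>A\<close>; it exceeds \<open>N\<close>, hence all labels of the end sequent.\<close>

definition child :: "nat \<Rightarrow> nat \<Rightarrow> nat \<Rightarrow> nat" where
  "child N w a = Suc (N + prod_encode (w, a))"

text \<open>The index counts generations of created labels, starting from the labels up to
  \<open>N\<close>; \<open>admissible\<close> charges it against \<open>jdepth\<close>.\<close>

inductive level :: "nat \<Rightarrow> nat \<Rightarrow> nat \<Rightarrow> bool" for N where
  level_0: "w \<le> N \<Longrightarrow> level N 0 w"
| level_Suc: "level N i w \<Longrightarrow> a \<le> N \<Longrightarrow> level N (Suc i) (child N w a)"

primrec label_bound :: "nat \<Rightarrow> nat \<Rightarrow> nat" where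
  "label_bound N 0 = Suc N"
| "label_bound N (Suc i) = Suc (child N (label_bound N i) N)"

lemma label_bound_mono: "i \<le> j \<Longrightarrow> label_bound N i \<le> label_bound N j"
proof (induction rule: dec_induct)
  case (step n)
  have "label_bound N n \<le> label_bound N (Suc n)"
    using le_prod_encode_1[of "label_bound N n" N] by (simp add: child_def)
  then show ?case using step by linarith
qed simp

lemma level_less: "level N i w \<Longrightarrow> w < label_bound N i"
proof (induction rule: level.induct)
  case (level_Suc i w a)
  then have "child N w a \<le> child N (label_bound N i) N"
    unfolding child_def using prod_encode_mono[of w "label_bound N i" a N] by simp
  then show ?case by simp
qed simp

text \<open>\<open>N\<close> generations suffice, because \<open>admissible\<close> keeps generation
  plus depth at most \<open>N\<close>. The same number also bounds term codes and formula
  codes.\<close>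

abbreviation bound :: "nat \<Rightarrow> nat" where
  "bound N \<equiv> label_bound N N"

lemma less_bound: "n \<le> N \<Longrightarrow> n < bound N"
  using label_bound_mono[of 0 N N] by simp

lemma level_less_bound: "level N i w \<Longrightarrow> i \<le> N \<Longrightarrow> w < bound N"
  using level_less label_bound_mono by (metis order_less_le_trans)

text \<open>A step to a created label raises the generation by one and strips one modality, which
  preserves the sum in the first clause. Steps to an original label may run in cycles, but there the
  generation is 0 and the code of \<open>A\<close> alone bounds its depth. The last conjunct for
  \<open>Rel\<close> leaves only these two kinds of steps.\<close>

primrec admissible :: "nat \<Rightarrow> item \<Rightarrow> bool" where
  "admissible N (Forces w A) \<longleftrightarrow> fm_code A \<le> N \<and> (\<exists>i. level N i w \<and> i + jdepth A \<le> N)"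
| "admissible N (Rel w v) \<longleftrightarrow> (\<exists>i\<le>N. level N i w) \<and> (\<exists>i\<le>N. level N i v) \<and>
     (v \<le> N \<or> (\<exists>a\<le>N. v = child N w a))"
| "admissible N (Evid w t A) \<longleftrightarrow>
     (\<exists>i\<le>N. level N i w) \<and> tm_code t < bound N \<and> fm_code A < bound N"

primrec item_below :: "nat \<Rightarrow> item \<Rightarrow> bool" where
  "item_below B (Forces w A) \<longleftrightarrow> w < B \<and> fm_code A < B"
| "item_below B (Rel w v) \<longleftrightarrow> w < B \<and> v < B"
| "item_below B (Evid w t A) \<longleftrightarrow> w < B \<and> tm_code t < B \<and> fm_code A < B"

lemma admissible_below: "admissible N x \<Longrightarrow> item_below (bound N) x"
  by (cases x) (auto intro: level_less_bound less_bound)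

lemma item_code_leD:
  assumes le: "item_code x \<le> N" shows "admissible N x \<and> (\<forall>v \<in> labels x. v \<le> N)"
proof (cases x)
  case (Forces w A)
  then have "w \<le> N" "fm_code A \<le> N" using le by (auto dest!: prod_encode_le_conjD)
  moreover have "0 + jdepth A \<le> N" using jdepth_le_fm_code[of A] calculation by simp
  ultimately have "\<exists>i. level N i w \<and> i + jdepth A \<le> N" using level_0[of w N] by blast
  then show ?thesis using Forces \<open>w \<le> N\<close> \<open>fm_code A \<le> N\<close> by simp
next
  case (Rel w v)
  then have "w \<le> N" "v \<le> N" using le by (auto dest!: prod_encode_le_conjD)
  moreover from this have "\<exists>i\<le>N. level N i w" "\<exists>i\<le>N. level N i v" using level_0 by blast+
  ultimately show ?thesis using Rel by simp
next
  case (Evid w t A)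
  then have "w \<le> N" "tm_code t \<le> N" "fm_code A \<le> N" using le by (auto dest!: prod_encode_le_conjD)
  moreover from this have "\<exists>i\<le>N. level N i w" using level_0 by blast
  ultimately show ?thesis using Evid less_bound by simp
qed

text \<open>Evidence atoms have the largest tag and the deepest nesting, so their shape at
  \<open>B\<close> dominates the codes of all items.\<close>

definition item_bound :: "nat \<Rightarrow> nat" where
  "item_bound B = Suc (prod_encode (2, prod_encode (B, prod_encode (B, B))))"

lemma item_code_less: "item_below B x \<Longrightarrow> item_code x < item_bound B"
proof (cases x)
  case (Forces w A)
  assume "item_below B x"
  then have "fm_code A \<le> prod_encode (B, B)" "w \<le> B"
    using le_prod_encode_1[of B B] Forces by auto
  then show ?thesis unfolding Forces item_bound_def by (auto simp: less_Suc_eq_le intro!: prod_encode_mono)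
next
  case (Rel w v)
  assume "item_below B x"
  then have "v \<le> prod_encode (B, B)" "w \<le> B"
    using le_prod_encode_1[of B B] Rel by auto
  then show ?thesis unfolding Rel item_bound_def by (auto simp: less_Suc_eq_le intro!: prod_encode_mono)
next
  case (Evid w t A)
  assume "item_below B x"
  then show ?thesis unfolding Evid item_bound_def
    by (auto simp: less_Suc_eq_le intro!: prod_encode_mono)
qed

lemma inj_item_code: "inj item_code"
  by (simp add: inj_def item_code_eq_iff)

lemma finite_admissible: "finite {x. admissible N x}"
proof -
  have "item_code ` {x. admissible N x} \<subseteq> {..<item_bound (bound N)}"
    using admissible_below item_code_less by auto
  then show ?thesis
    by (meson finite_lessThan finite_subset finite_imageD inj_item_code inj_on_subset subset_UNIV)
qed

section \<open>Search states and their extension\<close>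

primrec done_left :: "item set \<Rightarrow> item set \<Rightarrow> nat \<Rightarrow> fm \<Rightarrow> bool" where
  "done_left L R w (Prop P) \<longleftrightarrow> False"
| "done_left L R w Bot \<longleftrightarrow> False"
| "done_left L R w (Neg A) \<longleftrightarrow> Forces w A \<in> R"
| "done_left L R w (Conj A B) \<longleftrightarrow> Forces w A \<in> L \<and> Forces w B \<in> L"
| "done_left L R w (Disj A B) \<longleftrightarrow> Forces w A \<in> L \<or> Forces w B \<in> L"
| "done_left L R w (Imp A B) \<longleftrightarrow> Forces w A \<in> R \<or> Forces w B \<in> L"
| "done_left L R w (Just t A) \<longleftrightarrow> False"

text \<open>On the left \<open>t : A\<close> is never discharged, since its rules keep it in the
  premise. On the right the rule consumes it, so a recorded witness label counts as
  discharge.\<close>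

primrec done_right :: "item set \<Rightarrow> item set \<Rightarrow> nat \<Rightarrow> fm \<Rightarrow> bool" where
  "done_right L R w (Prop P) \<longleftrightarrow> False"
| "done_right L R w Bot \<longleftrightarrow> False"
| "done_right L R w (Neg A) \<longleftrightarrow> Forces w A \<in> L"
| "done_right L R w (Conj A B) \<longleftrightarrow> Forces w A \<in> R \<or> Forces w B \<in> R"
| "done_right L R w (Disj A B) \<longleftrightarrow> Forces w A \<in> R \<and> Forces w B \<in> R"
| "done_right L R w (Imp A B) \<longleftrightarrow> Forces w A \<in> L \<and> Forces w B \<in> R"
| "done_right L R w (Just t A) \<longleftrightarrow> (\<exists>v. Rel w v \<in> L \<and> Forces v A \<in> R)"

lemma done_left_mono:
  "done_left L R w A \<Longrightarrow> L \<subseteq> L' \<Longrightarrow> R \<subseteq> R' \<Longrightarrow> done_left L' R' w A"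
  by (cases A) auto

lemma done_right_mono:
  "done_right L R w A \<Longrightarrow> L \<subseteq> L' \<Longrightarrow> R \<subseteq> R' \<Longrightarrow> done_right L' R' w A"
  by (cases A) auto

text \<open>A state of the proof search: an underivable sequent together with the sets \<open>L\<close> and \<open>R\<close> of
  all items seen so far. An item may leave the sequent only once it is saturated in \<open>L\<close> and
  \<open>R\<close>, so neither contraction nor inversion of rules is needed.\<close>

locale search_state =
  fixes CS :: "fm set" and N :: nat and \<Gamma> \<Delta> :: "item multiset" and L R :: "item set"
  assumes underivable: "\<not> G3J CS \<Gamma> \<Delta>"
    and Gamma_sub: "x \<in># \<Gamma> \<Longrightarrow> x \<in> L"
    and Delta_sub: "x \<in># \<Delta> \<Longrightarrow> x \<in> R"
    and adm_L: "x \<in> L \<Longrightarrow> admissible N x"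
    and adm_R: "x \<in> R \<Longrightarrow> admissible N x"
    and L_cases: "x \<in> L \<Longrightarrow> x \<in># \<Gamma> \<or> (\<exists>w A. x = Forces w A \<and> done_left L R w A)"
    and R_cases: "x \<in> R \<Longrightarrow> x \<in># \<Delta> \<or> (\<exists>w A. x = Forces w A \<and> done_right L R w A)"
    and child_used: "x \<in> L \<union> R \<Longrightarrow> child N w (fm_code A) \<in> labels x \<Longrightarrow>
      Rel w (child N w (fm_code A)) \<in> L \<and> Forces (child N w (fm_code A)) A \<in> R"
begin

text \<open>Items discharged earlier stay discharged, because both notions are monotone in the
  recorded sets; only items dropped by the current rule need a justification.\<close>

lemma extend:
  assumes nd: "\<not> G3J CS \<Gamma>' \<Delta>'"
    and adm: "\<forall>x \<in> set_mset \<Gamma>' \<union> set_mset \<Delta>'. x \<in> L \<union> R \<or> admissible N x"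
    and left: "\<forall>x. x \<in># \<Gamma> \<longrightarrow> x \<notin># \<Gamma>' \<longrightarrow>
      (\<exists>w A. x = Forces w A \<and> done_left (L \<union> set_mset \<Gamma>') (R \<union> set_mset \<Delta>') w A)"
    and right: "\<forall>x. x \<in># \<Delta> \<longrightarrow> x \<notin># \<Delta>' \<longrightarrow>
      (\<exists>w A. x = Forces w A \<and> done_right (L \<union> set_mset \<Gamma>') (R \<union> set_mset \<Delta>') w A)"
    and lab: "\<forall>x w A. x \<in> set_mset \<Gamma>' \<union> set_mset \<Delta>' \<longrightarrow> child N w (fm_code A) \<in> labels x \<longrightarrow>
      child N w (fm_code A) \<in> \<Union>(labels ` (L \<union> R)) \<or>
      Rel w (child N w (fm_code A)) \<in> L \<union> set_mset \<Gamma>' \<and>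
      Forces (child N w (fm_code A)) A \<in> R \<union> set_mset \<Delta>'"
  shows "search_state CS N \<Gamma>' \<Delta>' (L \<union> set_mset \<Gamma>') (R \<union> set_mset \<Delta>')"
    (is "search_state CS N \<Gamma>' \<Delta>' ?L ?R")
proof
  fix x
  show "admissible N x" if "x \<in> ?L" using that adm adm_L adm_R by blast
  show "admissible N x" if "x \<in> ?R" using that adm adm_L adm_R by blast
  show "x \<in># \<Gamma>' \<or> (\<exists>w A. x = Forces w A \<and> done_left ?L ?R w A)" if "x \<in> ?L"
  proof -
    consider "x \<in># \<Gamma>'" | "x \<in># \<Gamma>" "x \<notin># \<Gamma>'" | w A where "x = Forces w A" "done_left L R w A"
      using \<open>x \<in> ?L\<close> L_cases[of x] by blast
    then show ?thesis
      using left done_left_mono[of L R _ _ ?L ?R] by cases blast+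
  qed
  show "x \<in># \<Delta>' \<or> (\<exists>w A. x = Forces w A \<and> done_right ?L ?R w A)" if "x \<in> ?R"
  proof -
    consider "x \<in># \<Delta>'" | "x \<in># \<Delta>" "x \<notin># \<Delta>'" | w A where "x = Forces w A" "done_right L R w A"
      using \<open>x \<in> ?R\<close> R_cases[of x] by blast
    then show ?thesis
      using right done_right_mono[of L R _ _ ?L ?R] by cases blast+
  qed
  fix w A
  let ?v = "child N w (fm_code A)"
  assume x: "x \<in> ?L \<union> ?R" "?v \<in> labels x"
  show "Rel w ?v \<in> ?L \<and> Forces ?v A \<in> ?R"
  proof (cases "?v \<in> \<Union>(labels ` (L \<union> R))")
    case True
    then show ?thesis using child_used by blast
  next
    case False
    then have "x \<in> set_mset \<Gamma>' \<union> set_mset \<Delta>'" using x by blast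
    then show ?thesis using False x(2) lab by blast
  qed
qed (use nd in simp_all)

end

section \<open>Saturation of a maximal state\<close>

locale maximal_state = search_state +
  assumes CS_le: "\<forall>F \<in> CS. fm_code F \<le> N"
    and maximal: "search_state CS N \<Gamma>' \<Delta>' L' R' \<Longrightarrow> L \<subseteq> L' \<Longrightarrow> R \<subseteq> R' \<Longrightarrow> L' = L \<and> R' = R"
begin

text \<open>Under these side conditions an underivable premise of a backward rule yields a state
  with sets at least as large, so by maximality all that the rule produces was already
  recorded.\<close>

lemma step:
  assumes "\<not> G3J CS \<Gamma>' \<Delta>'"
    and "\<forall>x \<in> set_mset \<Gamma>' \<union> set_mset \<Delta>'. x \<in> L \<union> R \<or> admissible N x"
    and "\<forall>x. x \<in># \<Gamma> \<longrightarrow> x \<notin># \<Gamma>' \<longrightarrow>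
      (\<exists>w A. x = Forces w A \<and> done_left (L \<union> set_mset \<Gamma>') (R \<union> set_mset \<Delta>') w A)"
    and "\<forall>x. x \<in># \<Delta> \<longrightarrow> x \<notin># \<Delta>' \<longrightarrow>
      (\<exists>w A. x = Forces w A \<and> done_right (L \<union> set_mset \<Gamma>') (R \<union> set_mset \<Delta>') w A)"
    and "\<forall>x w A. x \<in> set_mset \<Gamma>' \<union> set_mset \<Delta>' \<longrightarrow> child N w (fm_code A) \<in> labels x \<longrightarrow>
      child N w (fm_code A) \<in> \<Union>(labels ` (L \<union> R)) \<or>
      Rel w (child N w (fm_code A)) \<in> L \<union> set_mset \<Gamma>' \<and>
      Forces (child N w (fm_code A)) A \<in> R \<union> set_mset \<Delta>'"
  shows "set_mset \<Gamma>' \<subseteq> L" "set_mset \<Delta>' \<subseteq> R"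
  using maximal[OF extend[OF assms]] by auto

lemma step_old_labels:
  assumes "\<not> G3J CS \<Gamma>' \<Delta>'"
    and "\<forall>x \<in> set_mset \<Gamma>' \<union> set_mset \<Delta>'. x \<in> L \<union> R \<or>
      admissible N x \<and> labels x \<subseteq> \<Union>(labels ` (L \<union> R))"
    and "\<forall>x. x \<in># \<Gamma> \<longrightarrow> x \<notin># \<Gamma>' \<longrightarrow>
      (\<exists>w A. x = Forces w A \<and> done_left (L \<union> set_mset \<Gamma>') (R \<union> set_mset \<Delta>') w A)"
    and "\<forall>x. x \<in># \<Delta> \<longrightarrow> x \<notin># \<Delta>' \<longrightarrow>
      (\<exists>w A. x = Forces w A \<and> done_right (L \<union> set_mset \<Gamma>') (R \<union> set_mset \<Delta>') w A)"
  shows "set_mset \<Gamma>' \<subseteq> L" "set_mset \<Delta>' \<subseteq> R"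
proof -
  have "child N w (fm_code A) \<in> \<Union>(labels ` (L \<union> R))"
    if "x \<in> set_mset \<Gamma>' \<union> set_mset \<Delta>'" "child N w (fm_code A) \<in> labels x" for x w A
    using assms(2) that by blast
  moreover have "\<forall>x \<in> set_mset \<Gamma>' \<union> set_mset \<Delta>'. x \<in> L \<union> R \<or> admissible N x"
    using assms(2) by blast
  ultimately show "set_mset \<Gamma>' \<subseteq> L" "set_mset \<Delta>' \<subseteq> R"
    using step[of \<Gamma>' \<Delta>'] assms(1,3,4) by blast+
qed

lemma label_in: "Forces w A \<in> L \<union> R \<or> Evid w t A \<in> L \<union> R \<Longrightarrow> w \<in> \<Union>(labels ` (L \<union> R))"
  by force

lemma adm_parts:
  "admissible N (Forces w (Neg A)) \<Longrightarrow> admissible N (Forces w A)"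
  "admissible N (Forces w (Conj A B)) \<Longrightarrow> admissible N (Forces w A) \<and> admissible N (Forces w B)"
  "admissible N (Forces w (Disj A B)) \<Longrightarrow> admissible N (Forces w A) \<and> admissible N (Forces w B)"
  "admissible N (Forces w (Imp A B)) \<Longrightarrow> admissible N (Forces w A) \<and> admissible N (Forces w B)"
  by (auto dest: prod_encode_leD)

text \<open>Pattern of all propositional cases: were the conclusion false, the formula would not be
  discharged and would still be in the sequent. Some premise of its rule is then underivable, and
  maximality records the new components, a contradiction.\<close>

lemma left_Neg: assumes "Forces w (Neg A) \<in> L" shows "Forces w A \<in> R"
proof (rule ccontr)
  assume n: "Forces w A \<notin> R"
  then have "Forces w (Neg A) \<in># \<Gamma>" using L_cases[OF assms] by auto
  then obtain \<Gamma>0 where \<Gamma>: "\<Gamma> = add_mset (Forces w (Neg A)) \<Gamma>0" by (meson mset_add)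
  have "\<not> G3J CS \<Gamma>0 (add_mset (Forces w A) \<Delta>)"
    using underivable \<Gamma> G3J.L_neg by blast
  from step_old_labels(2)[OF this] show False
    using n adm_parts(1)[OF adm_L[OF assms]] Gamma_sub Delta_sub label_in[of w "Neg A"] assms \<Gamma> by auto
qed

lemma right_Neg: assumes "Forces w (Neg A) \<in> R" shows "Forces w A \<in> L"
proof (rule ccontr)
  assume n: "Forces w A \<notin> L"
  then have "Forces w (Neg A) \<in># \<Delta>" using R_cases[OF assms] by auto
  then obtain \<Delta>0 where \<Delta>: "\<Delta> = add_mset (Forces w (Neg A)) \<Delta>0" by (meson mset_add)
  have "\<not> G3J CS (add_mset (Forces w A) \<Gamma>) \<Delta>0"
    using underivable \<Delta> G3J.R_neg by blast
  from step_old_labels(1)[OF this] show False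
    using n adm_parts(1)[OF adm_R[OF assms]] Gamma_sub Delta_sub label_in[of w "Neg A"] assms \<Delta> by auto
qed

lemma left_Conj: assumes "Forces w (Conj A B) \<in> L" shows "Forces w A \<in> L \<and> Forces w B \<in> L"
proof (rule ccontr)
  assume n: "\<not> ?thesis"
  then have "Forces w (Conj A B) \<in># \<Gamma>" using L_cases[OF assms] by auto
  then obtain \<Gamma>0 where \<Gamma>: "\<Gamma> = add_mset (Forces w (Conj A B)) \<Gamma>0" by (meson mset_add)
  have "\<not> G3J CS (add_mset (Forces w A) (add_mset (Forces w B) \<Gamma>0)) \<Delta>"
    using underivable \<Gamma> G3J.L_conj by blast
  from step_old_labels(1)[OF this] show False
    using n adm_parts(2)[OF adm_L[OF assms]] Gamma_sub Delta_sub label_in[of w "Conj A B"] assms \<Gamma> by auto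
qed

lemma right_Conj: assumes "Forces w (Conj A B) \<in> R" shows "Forces w A \<in> R \<or> Forces w B \<in> R"
proof (rule ccontr)
  assume n: "\<not> ?thesis"
  then have "Forces w (Conj A B) \<in># \<Delta>" using R_cases[OF assms] by auto
  then obtain \<Delta>0 where \<Delta>: "\<Delta> = add_mset (Forces w (Conj A B)) \<Delta>0" by (meson mset_add)
  have "\<not> G3J CS \<Gamma> (add_mset (Forces w A) \<Delta>0) \<or> \<not> G3J CS \<Gamma> (add_mset (Forces w B) \<Delta>0)"
    using underivable \<Delta> G3J.R_conj by blast
  then show False
  proof
    assume "\<not> G3J CS \<Gamma> (add_mset (Forces w A) \<Delta>0)"
    from step_old_labels(2)[OF this] show False
      using n adm_parts(2)[OF adm_R[OF assms]] Gamma_sub Delta_sub label_in[of w "Conj A B"] assms \<Delta> by auto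
  next
    assume "\<not> G3J CS \<Gamma> (add_mset (Forces w B) \<Delta>0)"
    from step_old_labels(2)[OF this] show False
      using n adm_parts(2)[OF adm_R[OF assms]] Gamma_sub Delta_sub label_in[of w "Conj A B"] assms \<Delta> by auto
  qed
qed

lemma left_Disj: assumes "Forces w (Disj A B) \<in> L" shows "Forces w A \<in> L \<or> Forces w B \<in> L"
proof (rule ccontr)
  assume n: "\<not> ?thesis"
  then have "Forces w (Disj A B) \<in># \<Gamma>" using L_cases[OF assms] by auto
  then obtain \<Gamma>0 where \<Gamma>: "\<Gamma> = add_mset (Forces w (Disj A B)) \<Gamma>0" by (meson mset_add)
  have "\<not> G3J CS (add_mset (Forces w A) \<Gamma>0) \<Delta> \<or> \<not> G3J CS (add_mset (Forces w B) \<Gamma>0) \<Delta>"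
    using underivable \<Gamma> G3J.L_disj by blast
  then show False
  proof
    assume "\<not> G3J CS (add_mset (Forces w A) \<Gamma>0) \<Delta>"
    from step_old_labels(1)[OF this] show False
      using n adm_parts(3)[OF adm_L[OF assms]] Gamma_sub Delta_sub label_in[of w "Disj A B"] assms \<Gamma> by auto
  next
    assume "\<not> G3J CS (add_mset (Forces w B) \<Gamma>0) \<Delta>"
    from step_old_labels(1)[OF this] show False
      using n adm_parts(3)[OF adm_L[OF assms]] Gamma_sub Delta_sub label_in[of w "Disj A B"] assms \<Gamma> by auto
  qed
qed

lemma right_Disj: assumes "Forces w (Disj A B) \<in> R" shows "Forces w A \<in> R \<and> Forces w B \<in> R"
proof (rule ccontr)
  assume n: "\<not> ?thesis"
  then have "Forces w (Disj A B) \<in># \<Delta>" using R_cases[OF assms] by auto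
  then obtain \<Delta>0 where \<Delta>: "\<Delta> = add_mset (Forces w (Disj A B)) \<Delta>0" by (meson mset_add)
  have "\<not> G3J CS \<Gamma> (add_mset (Forces w A) (add_mset (Forces w B) \<Delta>0))"
    using underivable \<Delta> G3J.R_disj by blast
  from step_old_labels(2)[OF this] show False
    using n adm_parts(3)[OF adm_R[OF assms]] Gamma_sub Delta_sub label_in[of w "Disj A B"] assms \<Delta> by auto
qed

lemma left_Imp: assumes "Forces w (Imp A B) \<in> L" shows "Forces w A \<in> R \<or> Forces w B \<in> L"
proof (rule ccontr)
  assume n: "\<not> ?thesis"
  then have "Forces w (Imp A B) \<in># \<Gamma>" using L_cases[OF assms] by auto
  then obtain \<Gamma>0 where \<Gamma>: "\<Gamma> = add_mset (Forces w (Imp A B)) \<Gamma>0" by (meson mset_add)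
  have "\<not> G3J CS \<Gamma>0 (add_mset (Forces w A) \<Delta>) \<or> \<not> G3J CS (add_mset (Forces w B) \<Gamma>0) \<Delta>"
    using underivable \<Gamma> G3J.L_imp by blast
  then show False
  proof
    assume "\<not> G3J CS \<Gamma>0 (add_mset (Forces w A) \<Delta>)"
    from step_old_labels(2)[OF this] show False
      using n adm_parts(4)[OF adm_L[OF assms]] Gamma_sub Delta_sub label_in[of w "Imp A B"] assms \<Gamma> by auto
  next
    assume "\<not> G3J CS (add_mset (Forces w B) \<Gamma>0) \<Delta>"
    from step_old_labels(1)[OF this] show False
      using n adm_parts(4)[OF adm_L[OF assms]] Gamma_sub Delta_sub label_in[of w "Imp A B"] assms \<Gamma> by auto
  qed
qed

lemma right_Imp: assumes "Forces w (Imp A B) \<in> R" shows "Forces w A \<in> L \<and> Forces w B \<in> R"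
proof (rule ccontr)
  assume n: "\<not> ?thesis"
  then have "Forces w (Imp A B) \<in># \<Delta>" using R_cases[OF assms] by auto
  then obtain \<Delta>0 where \<Delta>: "\<Delta> = add_mset (Forces w (Imp A B)) \<Delta>0" by (meson mset_add)
  have "\<not> G3J CS (add_mset (Forces w A) \<Gamma>) (add_mset (Forces w B) \<Delta>0)"
    using underivable \<Delta> G3J.R_imp by blast
  moreover have w: "\<exists>x\<in>R. w \<in> labels x" by (intro bexI[OF _ assms]) simp
  ultimately have "set_mset (add_mset (Forces w A) \<Gamma>) \<subseteq> L \<and> set_mset (add_mset (Forces w B) \<Delta>0) \<subseteq> R"
    by (intro conjI step_old_labels)
      (use adm_parts(4)[OF adm_R[OF assms]] Gamma_sub Delta_sub assms \<Delta> w in \<open>auto simp del: admissible.simps\<close>)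
  then show False using n by simp
qed

text \<open>These shapes are never discharged, so they stay in the sequent and remain available as
  principal items.\<close>

lemma persistent_left:
  "Forces w (Just t A) \<in> L \<Longrightarrow> Forces w (Just t A) \<in># \<Gamma>"
  "Forces w (Prop P) \<in> L \<Longrightarrow> Forces w (Prop P) \<in># \<Gamma>"
  "Forces w Bot \<in> L \<Longrightarrow> Forces w Bot \<in># \<Gamma>"
  "Rel w v \<in> L \<Longrightarrow> Rel w v \<in># \<Gamma>"
  "Evid w t A \<in> L \<Longrightarrow> Evid w t A \<in># \<Gamma>"
  using L_cases by fastforce+

lemma persistent_right:
  "Forces w (Prop P) \<in> R \<Longrightarrow> Forces w (Prop P) \<in># \<Delta>"
  "Rel w v \<in> R \<Longrightarrow> Rel w v \<in># \<Delta>"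
  "Evid w t A \<in> R \<Longrightarrow> Evid w t A \<in># \<Delta>"
  using R_cases by fastforce+

lemma add_left:
  assumes "\<not> G3J CS (add_mset x \<Gamma>) \<Delta>" "admissible N x" "labels x \<subseteq> \<Union>(labels ` (L \<union> R))"
  shows "x \<in> L"
proof -
  have "set_mset (add_mset x \<Gamma>) \<subseteq> L"
    by (rule step_old_labels(1)[OF assms(1)]) (use assms(2,3) Gamma_sub Delta_sub in auto)
  then show ?thesis by simp
qed

lemma mset_add2:
  assumes "x \<in># M" "y \<in># M" "x \<noteq> y"
  obtains M' where "M = add_mset x (add_mset y M')"
  using assms by (metis insert_noteq_member mset_add)

lemma left_Just:
  assumes "Forces w (Just t A) \<in> L" "Rel w v \<in> L" shows "Forces v A \<in> L"
proof (rule add_left)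
  obtain \<Gamma>0 where \<Gamma>: "\<Gamma> = add_mset (Forces w (Just t A)) (add_mset (Rel w v) \<Gamma>0)"
    using mset_add2[OF persistent_left(1)[OF assms(1)] persistent_left(4)[OF assms(2)]] by blast
  show "\<not> G3J CS (add_mset (Forces v A) \<Gamma>) \<Delta>"
    using underivable \<Gamma> G3J.L_just by blast
  obtain i where i: "level N i w" "i + jdepth (Just t A) \<le> N" and A: "fm_code A \<le> N"
    using adm_L[OF assms(1)] by (auto dest: prod_encode_leD)
  \<comment> \<open>At an original label the code of \<open>A\<close> bounds its depth; at a child
    of \<open>w\<close> the additional generation is paid for by the modality that is
    stripped.\<close>
  consider "v \<le> N" | a where "a \<le> N" "v = child N w a"
    using adm_L[OF assms(2)] by auto
  then show "admissible N (Forces v A)"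
  proof cases
    case 1
    then have "level N 0 v" by (rule level_0)
    moreover have "0 + jdepth A \<le> N" using jdepth_le_fm_code[of A] A by simp
    ultimately show ?thesis using A by auto
  next
    case 2
    then have "level N (Suc i) v" using level_Suc[OF i(1)] by simp
    moreover have "Suc i + jdepth A \<le> N" using i(2) by simp
    ultimately show ?thesis using A by (simp only: admissible.simps) blast
  qed
  show "labels (Forces v A) \<subseteq> \<Union>(labels ` (L \<union> R))"
    using assms(2) by force
qed

lemma right_Just:
  assumes "Forces w (Just t A) \<in> R" "Evid w t A \<in> L"
  shows "\<exists>v. Rel w v \<in> L \<and> Forces v A \<in> R"
proof (rule ccontr)
  assume n: "\<nexists>v. Rel w v \<in> L \<and> Forces v A \<in> R"
  then have "Forces w (Just t A) \<in># \<Delta>" using R_cases[OF assms(1)] by auto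
  then obtain \<Delta>0 where \<Delta>: "\<Delta> = add_mset (Forces w (Just t A)) \<Delta>0" by (meson mset_add)
  obtain \<Gamma>0 where \<Gamma>: "\<Gamma> = add_mset (Evid w t A) \<Gamma>0"
    using persistent_left(5)[OF assms(2)] by (meson mset_add)
  \<comment> \<open>The canonical name is a legitimate eigenvariable: by \<open>child_used\<close>,
    an occurrence of it would already provide the witness assumed to be missing.\<close>
  define v where "v = child N w (fm_code A)"
  have fresh: "v \<notin> labels x" if "x \<in> L \<union> R" for x
    using child_used[OF that] n unfolding v_def by blast
  have "v \<notin> mset_labels \<Gamma>" "v \<notin> mset_labels \<Delta>"
    using fresh Gamma_sub Delta_sub by (auto simp: mset_labels_def)
  then have nd: "\<not> G3J CS (add_mset (Rel w v) \<Gamma>) (add_mset (Forces v A) \<Delta>0)"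
    using underivable G3J.R_just[of CS w v t A \<Gamma>0 \<Delta>0] unfolding \<Gamma> \<Delta> by blast
  obtain i where i: "level N i w" "i + jdepth (Just t A) \<le> N" and A: "fm_code A \<le> N"
    using adm_R[OF assms(1)] by (auto dest: prod_encode_leD)
  have lev: "level N (Suc i) v" "Suc i + jdepth A \<le> N"
    using level_Suc[OF i(1) A] i(2) by (simp_all add: v_def)
  have aF: "admissible N (Forces v A)"
    using lev A by (simp only: admissible.simps) blast
  have "i \<le> N" "Suc i \<le> N" using lev(2) by simp_all
  then have aR: "admissible N (Rel w v)"
    using lev(1) i(1) A unfolding admissible.simps v_def by blast
  have w: "w \<in> \<Union>(labels ` (L \<union> R))" using label_in[of w "Just t A"] assms(1) by auto
  \<comment> \<open>The name determines \<open>w\<close> and \<open>A\<close>, so for the new label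
    the invariant \<open>child_used\<close> concerns this pair only, and the two added items are
    exactly what it asks for.\<close>
  have inj: "w' = w \<and> A' = A" if "child N w' (fm_code A') = v" for w' A'
    using that by (auto simp: v_def child_def fm_code_eq_iff)
  have "set_mset (add_mset (Rel w v) \<Gamma>) \<subseteq> L \<and> set_mset (add_mset (Forces v A) \<Delta>0) \<subseteq> R"
  proof (intro conjI step[OF nd])
    show "\<forall>x w' A'. x \<in> set_mset (add_mset (Rel w v) \<Gamma>) \<union> set_mset (add_mset (Forces v A) \<Delta>0) \<longrightarrow>
       child N w' (fm_code A') \<in> labels x \<longrightarrow>
       child N w' (fm_code A') \<in> \<Union> (labels ` (L \<union> R)) \<or>
       Rel w' (child N w' (fm_code A')) \<in> L \<union> set_mset (add_mset (Rel w v) \<Gamma>) \<and>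
       Forces (child N w' (fm_code A')) A' \<in> R \<union> set_mset (add_mset (Forces v A) \<Delta>0)" (is "\<forall>x w' A'. ?P x w' A'")
    proof (intro allI)
      fix x w' A'
      show "?P x w' A'"
      proof (cases "child N w' (fm_code A') = v")
        case True
        then show ?thesis using inj by auto
      next
        case False
        then show ?thesis using w Gamma_sub Delta_sub unfolding \<Delta> by auto
      qed
    qed
    then show "\<forall>x w' A'. ?P x w' A'" .
  qed (use aF aR Gamma_sub Delta_sub \<Delta> in auto)
  then show False using n by auto
qed

lemma left_E: assumes "Forces w (Just t A) \<in> L" shows "Evid w t A \<in> L"
proof (rule add_left)
  obtain \<Gamma>0 where \<Gamma>: "\<Gamma> = add_mset (Forces w (Just t A)) \<Gamma>0"
    using persistent_left(1)[OF assms] by (meson mset_add)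
  show "\<not> G3J CS (add_mset (Evid w t A) \<Gamma>) \<Delta>"
    using underivable \<Gamma> G3J.E by blast
  obtain i where "level N i w" "i + jdepth (Just t A) \<le> N" and "fm_code A \<le> N" "tm_code t \<le> N"
    using adm_L[OF assms] by (auto dest: prod_encode_leD)
  then show "admissible N (Evid w t A)"
    by (auto intro!: less_bound exI[of _ i])
qed (use label_in[of w "Just t A"] assms in auto)

lemma left_plus:
  assumes "tm_code (Plus s t) < bound N" "Evid w t A \<in> L" shows "Evid w (Plus s t) A \<in> L"
proof (rule add_left)
  obtain \<Gamma>0 where \<Gamma>: "\<Gamma> = add_mset (Evid w t A) \<Gamma>0"
    using persistent_left(5)[OF assms(2)] by (meson mset_add)
  show "\<not> G3J CS (add_mset (Evid w (Plus s t) A) \<Gamma>) \<Delta>"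
    using underivable \<Gamma> G3J.El_plus by blast
qed (use adm_L[OF assms(2)] assms(1) label_in[of w A t] assms in auto)

lemma right_plus:
  assumes "tm_code (Plus t s) < bound N" "Evid w t A \<in> L" shows "Evid w (Plus t s) A \<in> L"
proof (rule add_left)
  obtain \<Gamma>0 where \<Gamma>: "\<Gamma> = add_mset (Evid w t A) \<Gamma>0"
    using persistent_left(5)[OF assms(2)] by (meson mset_add)
  show "\<not> G3J CS (add_mset (Evid w (Plus t s) A) \<Gamma>) \<Delta>"
    using underivable \<Gamma> G3J.Er_plus by blast
qed (use adm_L[OF assms(2)] assms(1) label_in[of w A t] assms in auto)

lemma left_app:
  assumes "tm_code (App s t) < bound N" "Evid w s (Imp A B) \<in> L" "Evid w t A \<in> L"
  shows "Evid w (App s t) B \<in> L"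
proof (rule add_left)
  \<comment> \<open>\<open>A\<close> is a proper subformula of \<open>Imp A B\<close>, so the two
    atoms differ even for \<open>s = t\<close> and can both be split off the multiset.\<close>
  have "Evid w s (Imp A B) \<noteq> Evid w t A" by (metis add.right_neutral add_Suc_right fm.size(13) item.inject(3) less_add_Suc1 nat_neq_iff not_add_less2)
  then obtain \<Gamma>0 where \<Gamma>: "\<Gamma> = add_mset (Evid w s (Imp A B)) (add_mset (Evid w t A) \<Gamma>0)"
    using mset_add2[OF persistent_left(5)[OF assms(2)] persistent_left(5)[OF assms(3)]] by blast
  show "\<not> G3J CS (add_mset (Evid w (App s t) B) \<Gamma>) \<Delta>"
    using underivable \<Gamma> G3J.E_app by blast
qed (use adm_L[OF assms(2)] assms(1) label_in[of w "Imp A B" s] assms in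
    \<open>auto dest: prod_encode_lessD\<close>)

lemma left_const:
  assumes "Forces w A \<in> R \<or> Evid w t A \<in> R" "Just (JConst c) F \<in> CS"
  shows "Evid w (JConst c) F \<in> L"
proof (rule add_left)
  show "\<not> G3J CS (add_mset (Evid w (JConst c) F) \<Gamma>) \<Delta>"
    using underivable G3J.IAN assms(2) by blast
  have "tm_code (JConst c) \<le> N" "fm_code F \<le> N"
    using prod_encode_leD[of 6 "prod_encode (tm_code (JConst c), fm_code F)" N]
      prod_encode_leD[of "tm_code (JConst c)" "fm_code F" N] bspec[OF CS_le assms(2)] by simp_all
  moreover have "\<exists>i\<le>N. level N i w"
    using assms(1) by (auto dest!: adm_R) (meson add_leD1)
  ultimately show "admissible N (Evid w (JConst c) F)"
    by (simp only: admissible.simps) (auto intro: less_bound)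
qed (use label_in[of w A t] assms in auto)

lemma consistent:
  "\<not> (Forces w (Prop P) \<in> L \<and> Forces w (Prop P) \<in> R)"
  "Forces w Bot \<notin> L"
  "\<not> (Rel w v \<in> L \<and> Rel w v \<in> R)"
  "\<not> (Evid w t A \<in> L \<and> Evid w t A \<in> R)"
  using underivable persistent_left persistent_right
    G3J.Ax_prop G3J.Ax_bot G3J.Ax_rel G3J.Ax_evid by (metis mset_add)+

lemma right_terms:
  "Forces w (Just t A) \<in> R \<Longrightarrow> tm_code t < bound N"
  "Evid w t A \<in> R \<Longrightarrow> tm_code t < bound N"
  by (auto dest!: adm_R prod_encode_le_conjD intro: less_bound)

lemma terms_closed:
  assumes "tm_code (Plus s t) < bound N \<or> tm_code (App s t) < bound N"
  shows "tm_code s < bound N \<and> tm_code t < bound N"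
  using assms by (auto dest: prod_encode_lessD)

text \<open>Taking all terms with code below the bound, rather than the subterms of the instance,
  makes closure under subterms immediate: pairing dominates its components.\<close>

sublocale hintikka CS "{t. tm_code t < bound N}" L R
proof (unfold_locales, unfold mem_Collect_eq)
qed (rule consistent left_Neg right_Neg left_Conj right_Conj left_Disj right_Disj left_Imp
    right_Imp left_E left_Just right_Just left_plus right_plus left_app
    left_const[OF disjI1] left_const[OF disjI2] right_terms terms_closed[OF disjI1]
    terms_closed[OF disjI2]; assumption)+

end

text \<open>Among the states containing the end sequent one has maximal total cardinality, since the
  sets consist of finitely many admissible items. It is then maximal under inclusion as
  well.\<close>

lemma underivable_hintikka:
  assumes nd: "\<not> G3J CS \<Gamma> \<Delta>"
    and CS: "\<forall>F \<in> CS. fm_code F \<le> N"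
    and items: "\<forall>x \<in> set_mset \<Gamma> \<union> set_mset \<Delta>. item_code x \<le> N"
  obtains L R where "hintikka CS {t. tm_code t < bound N} L R"
    "set_mset \<Gamma> \<subseteq> L" "set_mset \<Delta> \<subseteq> R" "\<forall>x \<in> L \<union> R. item_below (bound N) x"
proof -
  define P where "P p \<longleftrightarrow> (\<exists>\<Gamma>' \<Delta>'. search_state CS N \<Gamma>' \<Delta>' (fst p) (snd p)) \<and>
    set_mset \<Gamma> \<subseteq> fst p \<and> set_mset \<Delta> \<subseteq> snd p" for p
  define f where "f p = card (fst p) + card (snd p)" for p :: "item set \<times> item set"
  let ?U = "{x. admissible N x}"
  \<comment> \<open>Labels of the end sequent are at most \<open>N\<close>, hence none is a created
    one, and \<open>child_used\<close> holds vacuously at the start.\<close>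
  have lab: "\<forall>x \<in> set_mset \<Gamma> \<union> set_mset \<Delta>. child N w a \<notin> labels x" for w a
    using items item_code_leD by (fastforce simp: child_def)
  have "search_state CS N \<Gamma> \<Delta> (set_mset \<Gamma>) (set_mset \<Delta>)"
    by unfold_locales (use nd item_code_leD items lab in blast)+
  then have P0: "P (set_mset \<Gamma>, set_mset \<Delta>)" unfolding P_def by auto
  have sub: "fst p \<subseteq> ?U" "snd p \<subseteq> ?U" if "P p" for p
    using that search_state.adm_L search_state.adm_R unfolding P_def by fastforce+
  have "f p < Suc (card ?U + card ?U)" if "P p" for p
    using card_mono[OF finite_admissible sub(1)[OF that]] card_mono[OF finite_admissible sub(2)[OF that]]
    unfolding f_def by linarith
  then obtain p where p: "P p" "\<forall>q. P q \<longrightarrow> f q \<le> f p"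
    using ex_has_greatest_nat[of P _ f, OF P0] by blast
  obtain L R where LR: "p = (L, R)" by force
  obtain \<Gamma>' \<Delta>' where st: "search_state CS N \<Gamma>' \<Delta>' L R"
    and start: "set_mset \<Gamma> \<subseteq> L" "set_mset \<Delta> \<subseteq> R"
    using p(1) LR unfolding P_def by auto
  have max: "L' = L \<and> R' = R" if st': "search_state CS N \<Gamma>'' \<Delta>'' L' R'" and sub': "L \<subseteq> L'" "R \<subseteq> R'"
    for \<Gamma>'' \<Delta>'' L' R'
  proof -
    have P: "P (L', R')" using that start unfolding P_def by auto
    then have fin: "finite L'" "finite R'"
      using sub[OF P] finite_subset[OF _ finite_admissible] by auto
    have "card L' + card R' \<le> card L + card R" using p(2) P LR unfolding f_def by auto
    moreover have "card L \<le> card L'" "card R \<le> card R'" using fin sub' by (auto intro: card_mono)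
    ultimately have "card L' \<le> card L" "card R' \<le> card R" by auto
    then show ?thesis using fin sub' card_seteq by metis
  qed
  interpret maximal_state CS N \<Gamma>' \<Delta>' L R
    by (rule maximal_state.intro[OF st], unfold_locales) (use CS max in blast)+
  show thesis
    using that[OF hintikka_axioms start] adm_L adm_R admissible_below by blast
qed

section \<open>Recursive predicates\<close>

definition recursive_pred :: "nat \<Rightarrow> (nat list \<Rightarrow> bool) \<Rightarrow> bool" where
  "recursive_pred n P \<longleftrightarrow> recursive_fn n (\<lambda>xs. if P xs then 1 else 0)"

named_theorems rec_intros

section \<open>Closure properties of recursive functions\<close>

lemma recursive_fn_cong:
  "recursive_fn n f \<Longrightarrow> (\<And>xs. length xs = n \<Longrightarrow> g xs = f xs) \<Longrightarrow> recursive_fn n g"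
  using recursive_fn.ext by blast

lemma recursive_pred_cong:
  "recursive_pred n P \<Longrightarrow> (\<And>xs. length xs = n \<Longrightarrow> Q xs = P xs) \<Longrightarrow> recursive_pred n Q"
  unfolding recursive_pred_def by (erule recursive_fn_cong) simp

lemma recursive_fn_comp1:
  assumes "recursive_fn 1 h" "recursive_fn n f"
  shows "recursive_fn n (\<lambda>xs. h [f xs])"
  using recursive_fn.comp[of "[f]" h n] assms by simp

lemma recursive_fn_comp2:
  assumes "recursive_fn 2 h" "recursive_fn n f" "recursive_fn n g"
  shows "recursive_fn n (\<lambda>xs. h [f xs, g xs])"
  using recursive_fn.comp[of "[f, g]" h n] assms by (simp add: numeral_2_eq_2)

lemma recursive_fn_hd [rec_intros]: "recursive_fn (Suc n) (\<lambda>xs. hd xs)"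
  by (rule recursive_fn_cong[OF recursive_fn.proj[of 0]]) (auto simp: hd_conv_nth length_Suc_conv)

lemma recursive_fn_tl:
  assumes "recursive_fn n f" shows "recursive_fn (Suc n) (\<lambda>xs. f (tl xs))"
proof -
  let ?ps = "map (\<lambda>i xs. xs ! Suc i) [0..<n]"
  have "recursive_fn (Suc n) (\<lambda>xs. f (map (\<lambda>g. g xs) ?ps))"
    using assms by (intro recursive_fn.comp) (auto intro: recursive_fn.proj)
  then show ?thesis
  proof (rule recursive_fn_cong)
    fix xs :: "nat list"
    assume "length xs = Suc n"
    then have "tl xs = map (\<lambda>g. g xs) ?ps"
      by (intro nth_equalityI) (auto simp: nth_tl)
    then show "f (tl xs) = f (map (\<lambda>g. g xs) ?ps)" by simp
  qed
qed

text \<open>A bounded quantifier pushes its variable onto the argument list, so outer variables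
  become \<open>hd\<close> of iterated tails. Together with \<open>recursive_fn_hd\<close> this
  resolves such lookups; the leading \<open>hd\<close> restricts the rule to them.\<close>

lemma recursive_fn_hd_tl [rec_intros]:
  "recursive_fn n (\<lambda>xs. hd (f xs)) \<Longrightarrow> recursive_fn (Suc n) (\<lambda>xs. hd (f (tl xs)))"
  by (rule recursive_fn_tl)

lemma recursive_fn_Suc [rec_intros]:
  "recursive_fn n f \<Longrightarrow> recursive_fn n (\<lambda>xs. Suc (f xs))"
  using recursive_fn_comp1[OF recursive_fn.succ] by simp

lemma recursive_fn_const [rec_intros]: "recursive_fn n (\<lambda>xs. k)"
  by (induction k) (auto intro: recursive_fn.zero recursive_fn_Suc)

lemma recursive_fn_prim_rec:
  assumes "recursive_fn n f" "recursive_fn (Suc (Suc n)) g"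
    and "\<And>xs. length xs = n \<Longrightarrow> h 0 xs = f xs"
    and "\<And>y xs. length xs = n \<Longrightarrow> h (Suc y) xs = g (y # h y xs # xs)"
  shows "recursive_fn (Suc n) (\<lambda>xs. h (hd xs) (tl xs))"
proof (rule recursive_fn_cong[OF recursive_fn.prim_rec[OF assms(1,2)]])
  fix xs :: "nat list"
  assume len: "length xs = Suc n"
  have "h y (tl xs) = rec_nat (f (tl xs)) (\<lambda>y r. g (y # r # tl xs)) y" for y
    using assms(3,4)[of "tl xs"] len by (induction y) auto
  then show "h (hd xs) (tl xs) = rec_nat (f (tl xs)) (\<lambda>y r. g (y # r # tl xs)) (hd xs)" .
qed

lemma recursive_fn_binary:
  assumes "recursive_fn (Suc (Suc 0)) (\<lambda>xs. h (hd xs) (hd (tl xs)))" "recursive_fn n f" "recursive_fn n g"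
  shows "recursive_fn n (\<lambda>xs. h (f xs) (g xs))"
  using recursive_fn_comp2[of "\<lambda>xs. h (hd xs) (hd (tl xs))" n f g] assms by (simp add: numeral_2_eq_2)

lemma recursive_fn_unary:
  assumes "recursive_fn (Suc 0) (\<lambda>xs. h (hd xs))" "recursive_fn n f"
  shows "recursive_fn n (\<lambda>xs. h (f xs))"
  using recursive_fn_comp1[of "\<lambda>xs. h (hd xs)" n f] assms by simp

lemma recursive_fn_add [rec_intros]:
  assumes "recursive_fn n f" "recursive_fn n g" shows "recursive_fn n (\<lambda>xs. f xs + g xs)"
proof (rule recursive_fn_binary[OF _ assms])
  show "recursive_fn (Suc (Suc 0)) (\<lambda>xs. hd xs + hd (tl xs))"
    by (rule recursive_fn_prim_rec[where h = "\<lambda>y xs. y + hd xs"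
          and f = "\<lambda>xs. hd xs" and g = "\<lambda>xs. Suc (hd (tl xs))"]) (intro rec_intros | simp)+
qed

lemma recursive_fn_mult [rec_intros]:
  assumes "recursive_fn n f" "recursive_fn n g" shows "recursive_fn n (\<lambda>xs. f xs * g xs)"
proof (rule recursive_fn_binary[OF _ assms])
  show "recursive_fn (Suc (Suc 0)) (\<lambda>xs. hd xs * hd (tl xs))"
    by (rule recursive_fn_prim_rec[where h = "\<lambda>y xs. y * hd xs"
          and f = "\<lambda>xs. 0" and g = "\<lambda>xs. hd (tl (tl xs)) + hd (tl xs)"]) (intro rec_intros | simp)+
qed

lemma recursive_fn_pred:
  assumes "recursive_fn n f" shows "recursive_fn n (\<lambda>xs. f xs - 1)"
proof (rule recursive_fn_unary[OF _ assms])
  show "recursive_fn (Suc 0) (\<lambda>xs. hd xs - 1)"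
    by (rule recursive_fn_prim_rec[where h = "\<lambda>y xs. y - 1"
          and f = "\<lambda>xs. 0" and g = "\<lambda>xs. hd xs"]) (intro rec_intros | simp)+
qed

lemma recursive_fn_diff [rec_intros]:
  assumes "recursive_fn n f" "recursive_fn n g" shows "recursive_fn n (\<lambda>xs. f xs - g xs)"
\<comment> \<open>Primitive recursion acts on the first argument, which has to be the subtrahend;
  hence the exchange.\<close>
proof (rule recursive_fn_binary[of "\<lambda>a b. b - a", OF _ assms(2,1)])
  show "recursive_fn (Suc (Suc 0)) (\<lambda>xs. hd (tl xs) - hd xs)"
    by (rule recursive_fn_prim_rec[where h = "\<lambda>y xs. hd xs - y"
          and f = "\<lambda>xs. hd xs" and g = "\<lambda>xs. hd (tl xs) - 1"])
      (intro rec_intros recursive_fn_pred | simp)+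
qed

lemma recursive_fn_power [rec_intros]:
  assumes "recursive_fn n f" shows "recursive_fn n (\<lambda>xs. 2 ^ f xs)"
proof (rule recursive_fn_unary[OF _ assms])
  show "recursive_fn (Suc 0) (\<lambda>xs. 2 ^ hd xs)"
    by (rule recursive_fn_prim_rec[where h = "\<lambda>y xs. 2 ^ y"
          and f = "\<lambda>xs. 1" and g = "\<lambda>xs. 2 * hd (tl xs)"]) (intro rec_intros | simp)+
qed

lemma recursive_fn_triangle [rec_intros]:
  assumes "recursive_fn n f" shows "recursive_fn n (\<lambda>xs. triangle (f xs))"
proof (rule recursive_fn_unary[OF _ assms])
  show "recursive_fn (Suc 0) (\<lambda>xs. triangle (hd xs))"
    by (rule recursive_fn_prim_rec[where h = "\<lambda>y xs. triangle y"
          and f = "\<lambda>xs. 0" and g = "\<lambda>xs. hd (tl xs) + Suc (hd xs)"]) (intro rec_intros | simp)+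
qed

lemma recursive_fn_prod_encode [rec_intros]:
  assumes "recursive_fn n f" "recursive_fn n g"
  shows "recursive_fn n (\<lambda>xs. prod_encode (f xs, g xs))"
  unfolding prod_encode_def case_prod_conv by (intro rec_intros assms)

lemma recursive_fn_label_bound [rec_intros]:
  assumes "recursive_fn n f" "recursive_fn n g"
  shows "recursive_fn n (\<lambda>xs. label_bound (f xs) (g xs))"
proof (rule recursive_fn_binary[of "\<lambda>a b. label_bound b a", OF _ assms(2,1)])
  show "recursive_fn (Suc (Suc 0)) (\<lambda>xs. label_bound (hd (tl xs)) (hd xs))"
    by (rule recursive_fn_prim_rec[where h = "\<lambda>y xs. label_bound (hd xs) y"
          and f = "\<lambda>xs. Suc (hd xs)"
          and g = "\<lambda>xs. Suc (Suc (hd (tl (tl xs)) + prod_encode (hd (tl xs), hd (tl (tl xs)))))"])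
      (intro rec_intros | simp add: child_def)+
qed

section \<open>Boolean operations and bounded quantifiers\<close>

lemma recursive_pred_eq_0:
  assumes "recursive_fn n f" shows "recursive_pred n (\<lambda>xs. f xs = 0)"
proof -
  have "recursive_fn n (\<lambda>xs. 1 - f xs)" by (intro rec_intros assms)
  then show ?thesis unfolding recursive_pred_def by (rule recursive_fn_cong) auto
qed

lemma recursive_pred_not [rec_intros]:
  "recursive_pred n P \<Longrightarrow> recursive_pred n (\<lambda>xs. \<not> P xs)"
  unfolding recursive_pred_def[of n P]
  by (rule recursive_pred_cong[OF recursive_pred_eq_0]) auto

lemma recursive_pred_conj [rec_intros]:
  assumes "recursive_pred n P" "recursive_pred n Q"
  shows "recursive_pred n (\<lambda>xs. P xs \<and> Q xs)"
  using recursive_fn_mult[OF assms[unfolded recursive_pred_def]] unfolding recursive_pred_def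
  by (rule recursive_fn_cong) auto

lemma recursive_pred_disj [rec_intros]:
  assumes "recursive_pred n P" "recursive_pred n Q"
  shows "recursive_pred n (\<lambda>xs. P xs \<or> Q xs)"
  by (rule recursive_pred_cong[of n "\<lambda>xs. \<not> (\<not> P xs \<and> \<not> Q xs)"]) (intro rec_intros assms | simp)+

lemma recursive_pred_imp [rec_intros]:
  assumes "recursive_pred n P" "recursive_pred n Q"
  shows "recursive_pred n (\<lambda>xs. P xs \<longrightarrow> Q xs)"
  by (rule recursive_pred_cong[of n "\<lambda>xs. \<not> P xs \<or> Q xs"]) (intro rec_intros assms | simp)+

lemma recursive_pred_le [rec_intros]:
  assumes "recursive_fn n f" "recursive_fn n g"
  shows "recursive_pred n (\<lambda>xs. f xs \<le> g xs)"
  by (rule recursive_pred_cong[of n "\<lambda>xs. f xs - g xs = 0"])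
    (intro recursive_pred_eq_0 rec_intros assms | simp)+

lemma recursive_pred_eq [rec_intros]:
  assumes "recursive_fn n f" "recursive_fn n g"
  shows "recursive_pred n (\<lambda>xs. f xs = g xs)"
  by (rule recursive_pred_cong[of n "\<lambda>xs. f xs \<le> g xs \<and> g xs \<le> f xs"])
    (intro rec_intros assms | auto)+

text \<open>As a function of the bound, the characteristic function \<open>h\<close> of the
  quantifier is primitive recursive: each step multiplies in one more instance. The bound
  \<open>b\<close> is substituted afterwards.\<close>

lemma recursive_pred_all [rec_intros]:
  assumes "recursive_pred (Suc n) (\<lambda>ys. P (hd ys) (tl ys))" and b: "recursive_fn n b"
  shows "recursive_pred n (\<lambda>xs. \<forall>y < b xs. P y xs)"
proof -
  define h where "h y xs = (if \<forall>z < y. P z xs then 1 else 0 :: nat)" for y xs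
  have P: "recursive_fn (Suc n) (\<lambda>ys. if P (hd ys) (tl ys) then 1 else 0)"
    using assms(1) by (simp add: recursive_pred_def)
  \<comment> \<open>The step function receives the counter, the previous value and the parameters;
    \<open>P\<close> has to skip the value at position 1.\<close>
  let ?ps = "(\<lambda>xs :: nat list. xs ! 0) # map (\<lambda>i xs. xs ! (i + 2)) [0..<n]"
  have "recursive_fn (Suc (Suc n))
      (\<lambda>xs. (\<lambda>ys. if P (hd ys) (tl ys) then 1 else 0) (map (\<lambda>g. g xs) ?ps))"
    using P by (intro recursive_fn.comp) (auto intro: recursive_fn.proj)
  then have "recursive_fn (Suc (Suc n)) (\<lambda>xs. if P (hd xs) (tl (tl xs)) then 1 else 0)"
  proof (rule recursive_fn_cong)
    fix xs :: "nat list"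
    assume len: "length xs = Suc (Suc n)"
    then have "tl (tl xs) = map (\<lambda>g. g xs) (map (\<lambda>i xs. xs ! (i + 2)) [0..<n])"
      by (intro nth_equalityI) (auto simp: nth_tl)
    moreover have "hd xs = xs ! 0" using len by (cases xs) auto
    ultimately show "(if P (hd xs) (tl (tl xs)) then 1 else 0) =
        (\<lambda>ys. if P (hd ys) (tl ys) then 1 else 0) (map (\<lambda>g. g xs) ?ps)" by simp
  qed
  then have "recursive_fn (Suc (Suc n))
      (\<lambda>xs. hd (tl xs) * (if P (hd xs) (tl (tl xs)) then 1 else 0))"
    by (intro recursive_fn_mult rec_intros)
  from recursive_fn_prim_rec[OF recursive_fn_const[of n 1] this, of h]
  have h: "recursive_fn (Suc n) (\<lambda>xs. h (hd xs) (tl xs))"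
    by (auto simp: h_def less_Suc_eq)
  let ?qs = "b # map (\<lambda>i xs. xs ! i) [0..<n]"
  have "recursive_fn n (\<lambda>xs. (\<lambda>xs. h (hd xs) (tl xs)) (map (\<lambda>g. g xs) ?qs))"
    using h b by (intro recursive_fn.comp) (auto intro: recursive_fn.proj)
  then show ?thesis unfolding recursive_pred_def
  proof (rule recursive_fn_cong)
    fix xs :: "nat list"
    assume "length xs = n"
    then have "map (\<lambda>g. g xs) (map (\<lambda>i xs. xs ! i) [0..<n]) = xs"
      by (intro nth_equalityI) auto
    then show "(if \<forall>y < b xs. P y xs then 1 else 0) =
        (\<lambda>xs. h (hd xs) (tl xs)) (map (\<lambda>g. g xs) ?qs)"
      by (simp add: h_def)
  qed
qed

lemma recursive_pred_ex [rec_intros]: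
  assumes "recursive_pred (Suc n) (\<lambda>ys. P (hd ys) (tl ys))" and b: "recursive_fn n b"
  shows "recursive_pred n (\<lambda>xs. \<exists>y < b xs. P y xs)"
  by (rule recursive_pred_cong[of n "\<lambda>xs. \<not> (\<forall>y < b xs. \<not> P y xs)"])
    (intro rec_intros assms | simp)+

lemma recursive_pred_binary:
  assumes "recursive_pred (Suc (Suc 0)) (\<lambda>xs. P (hd xs) (hd (tl xs)))"
    "recursive_fn n f" "recursive_fn n g"
  shows "recursive_pred n (\<lambda>xs. P (f xs) (g xs))"
  using recursive_fn_binary[of "\<lambda>a b. if P a b then 1 else 0"] assms unfolding recursive_pred_def .

text \<open>Bit \<open>i\<close> is set when the quotient by \<open>2 ^ i\<close> is odd. Writing
  quotient and remainder as bounded witnesses leaves only sums, products and powers, so division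
  need not be treated as a recursive function.\<close>

lemma set_decode_iff:
  "i \<in> set_decode m \<longleftrightarrow> (\<exists>q < Suc m. \<exists>r < 2 ^ i. m = (2 * q + 1) * 2 ^ i + r)"
proof
  assume "i \<in> set_decode m"
  then have "odd (m div 2 ^ i)" by (simp add: set_decode_def)
  then have m: "m = (2 * (m div 2 ^ i div 2) + 1) * 2 ^ i + m mod 2 ^ i"
    by (metis div_mult_mod_eq odd_two_times_div_two_succ)
  have "m div 2 ^ i div 2 < Suc m" by (meson div_le_dividend le_imp_less_Suc le_trans)
  then show "\<exists>q < Suc m. \<exists>r < 2 ^ i. m = (2 * q + 1) * 2 ^ i + r"
    using m by (metis mod_less_divisor zero_less_numeral zero_less_power)
next
  assume "\<exists>q < Suc m. \<exists>r < 2 ^ i. m = (2 * q + 1) * 2 ^ i + r"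
  then obtain q r where "r < 2 ^ i" "m = (2 * q + 1) * 2 ^ i + r" by blast
  then have "m div 2 ^ i = 2 * q + 1" by (metis div_less div_mult_self3 power_not_zero
      add.commute add.right_neutral zero_neq_numeral)
  then show "i \<in> set_decode m" by (simp add: set_decode_def)
qed

lemma recursive_pred_set_decode [rec_intros]:
  assumes "recursive_fn n f" "recursive_fn n g"
  shows "recursive_pred n (\<lambda>xs. f xs \<in> set_decode (g xs))"
proof (rule recursive_pred_binary[of "\<lambda>a b. a \<in> set_decode b", OF _ assms])
  show "recursive_pred (Suc (Suc 0)) (\<lambda>xs. hd xs \<in> set_decode (hd (tl xs)))"
    unfolding set_decode_iff by (intro rec_intros)
qed

section \<open>Inclusion of a coded list in a bit set\<close>

lemma set_encode_less:
  assumes "A \<subseteq> {..<n}" shows "set_encode A < 2 ^ n"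
proof -
  have "set_encode A \<le> (\<Sum>i<n. 2 ^ i)"
    unfolding set_encode_def by (rule sum_mono2) (use assms in auto)
  also have "\<dots> < 2 ^ n" by (induction n) auto
  finally show ?thesis .
qed

text \<open>The bit set \<open>s\<close> contains the codes of all suffixes of the list coded by \<open>c\<close>, so that
  no unpairing function is needed.\<close>

definition list_subset :: "nat \<Rightarrow> nat \<Rightarrow> bool" where
  "list_subset c m \<longleftrightarrow> (\<exists>s < 2 ^ Suc c. c \<in> set_decode s \<and>
     (\<forall>a < c. \<forall>b < c. Suc (prod_encode (a, b)) \<in> set_decode s \<longrightarrow>
        a \<in> set_decode m \<and> b \<in> set_decode s))"

lemma list_encode_suffix_less:
  "Suc (prod_encode (a, b)) \<le> list_encode xs \<Longrightarrow> a < list_encode xs \<and> b < list_encode xs"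
  by (meson Suc_le_lessD le_prod_encode_1 le_prod_encode_2 order_le_less_trans)

text \<open>Junk in \<open>s\<close> does no harm: starting from the whole list, closure under tails
  forces every suffix into it. Conversely the suffix codes themselves form a witness, and none
  exceeds the code of the list, whence the bound \<open>2 ^ Suc c\<close>.\<close>

lemma list_subset_iff: "list_subset (list_encode xs) m \<longleftrightarrow> set xs \<subseteq> set_decode m"
proof
  assume "list_subset (list_encode xs) m"
  then obtain s where s: "list_encode xs \<in> set_decode s"
    "\<forall>a < list_encode xs. \<forall>b < list_encode xs. Suc (prod_encode (a, b)) \<in> set_decode s \<longrightarrow>
        a \<in> set_decode m \<and> b \<in> set_decode s"
    unfolding list_subset_def by blast
  have "set ys \<subseteq> set_decode m" if "list_encode ys \<in> set_decode s" "list_encode ys \<le> list_encode xs"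
    for ys using that
  proof (induction ys)
    case (Cons y ys)
    then have "y < list_encode xs" "list_encode ys < list_encode xs"
      using list_encode_suffix_less[of y "list_encode ys" xs] by simp_all
    then show ?case using Cons s(2) by auto
  qed simp
  then show "set xs \<subseteq> set_decode m" using s(1) by blast
next
  assume sub: "set xs \<subseteq> set_decode m"
  define S where "S = list_encode ` {ys. \<exists>zs. xs = zs @ ys}"
  have le: "list_encode ys \<le> list_encode (zs @ ys)" for zs ys
  proof (induction zs)
    case (Cons z zs)
    then show ?case using le_prod_encode_2[of "list_encode (zs @ ys)" z] by simp
  qed simp
  then have S: "S \<subseteq> {..<Suc (list_encode xs)}" unfolding S_def by (auto simp: less_Suc_eq_le)
  then have fin: "finite S" using finite_subset by blast
  have "list_encode xs \<in> S" unfolding S_def by force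
  moreover have "a \<in> set_decode m \<and> b \<in> S" if S': "Suc (prod_encode (a, b)) \<in> S" for a b
  proof -
    obtain ys zs where ys: "list_encode ys = Suc (prod_encode (a, b))" "xs = zs @ ys"
      using S' unfolding S_def by auto
    then obtain ys' where "ys = a # ys'" "b = list_encode ys'" by (cases ys) auto
    then show ?thesis using sub ys(2) unfolding S_def by (auto intro!: imageI exI[of _ "zs @ [a]"])
  qed
  ultimately show "list_subset (list_encode xs) m"
    unfolding list_subset_def using set_encode_less[OF S] fin
    by (intro exI[of _ "set_encode S"]) simp
qed

lemma recursive_pred_list_subset [rec_intros]:
  assumes "recursive_fn n f" "recursive_fn n g"
  shows "recursive_pred n (\<lambda>xs. list_subset (f xs) (g xs))"
proof (rule recursive_pred_binary[OF _ assms])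
  show "recursive_pred (Suc (Suc 0)) (\<lambda>xs. list_subset (hd xs) (hd (tl xs)))"
    unfolding list_subset_def by (intro rec_intros)
qed

section \<open>The arithmetized refutation search\<close>

abbreviation forces_code :: "nat \<Rightarrow> nat \<Rightarrow> nat" where
  "forces_code w a \<equiv> prod_encode (0, prod_encode (w, a))"

abbreviation rel_code :: "nat \<Rightarrow> nat \<Rightarrow> nat" where
  "rel_code w v \<equiv> prod_encode (1, prod_encode (w, v))"

abbreviation evid_code :: "nat \<Rightarrow> nat \<Rightarrow> nat \<Rightarrow> nat" where
  "evid_code w t a \<equiv> prod_encode (2, prod_encode (w, prod_encode (t, a)))"

abbreviation bin_code :: "nat \<Rightarrow> nat \<Rightarrow> nat \<Rightarrow> nat" where
  "bin_code i a b \<equiv> prod_encode (i, prod_encode (a, b))"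

text \<open>\<open>cs\<close>, \<open>ts\<close>, \<open>l\<close>, \<open>r\<close> are bit sets of codes representing the parameters of
  \<^locale>\<open>hintikka\<close>; all components of the coded objects are below \<open>B\<close>.\<close>

locale hintikka_code =
  fixes B cs ts l r :: nat
  assumes consistent_Prop: "\<forall>w<B. \<forall>a<B. \<not> (forces_code w (prod_encode (0, a)) \<in> set_decode l \<and>
       forces_code w (prod_encode (0, a)) \<in> set_decode r)"
    and consistent_Bot: "\<forall>w<B. \<not> forces_code w (prod_encode (1, 0)) \<in> set_decode l"
    and consistent_Rel: "\<forall>w<B. \<forall>v<B. \<not> (rel_code w v \<in> set_decode l \<and> rel_code w v \<in> set_decode r)"
    and consistent_Evid: "\<forall>w<B. \<forall>t<B. \<forall>a<B. \<not> (evid_code w t a \<in> set_decode l \<and> evid_code w t a \<in> set_decode r)"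
    and left_Neg: "\<forall>w<B. \<forall>a<B. forces_code w (prod_encode (2, a)) \<in> set_decode l \<longrightarrow>
       forces_code w a \<in> set_decode r"
    and right_Neg: "\<forall>w<B. \<forall>a<B. forces_code w (prod_encode (2, a)) \<in> set_decode r \<longrightarrow>
       forces_code w a \<in> set_decode l"
    and left_Conj: "\<forall>w<B. \<forall>a<B. \<forall>b<B. forces_code w (bin_code 3 a b) \<in> set_decode l \<longrightarrow>
       forces_code w a \<in> set_decode l \<and> forces_code w b \<in> set_decode l"
    and right_Conj: "\<forall>w<B. \<forall>a<B. \<forall>b<B. forces_code w (bin_code 3 a b) \<in> set_decode r \<longrightarrow>
       forces_code w a \<in> set_decode r \<or> forces_code w b \<in> set_decode r"
    and left_Disj: "\<forall>w<B. \<forall>a<B. \<forall>b<B. forces_code w (bin_code 4 a b) \<in> set_decode l \<longrightarrow>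
       forces_code w a \<in> set_decode l \<or> forces_code w b \<in> set_decode l"
    and right_Disj: "\<forall>w<B. \<forall>a<B. \<forall>b<B. forces_code w (bin_code 4 a b) \<in> set_decode r \<longrightarrow>
       forces_code w a \<in> set_decode r \<and> forces_code w b \<in> set_decode r"
    and left_Imp: "\<forall>w<B. \<forall>a<B. \<forall>b<B. forces_code w (bin_code 5 a b) \<in> set_decode l \<longrightarrow>
       forces_code w a \<in> set_decode r \<or> forces_code w b \<in> set_decode l"
    and right_Imp: "\<forall>w<B. \<forall>a<B. \<forall>b<B. forces_code w (bin_code 5 a b) \<in> set_decode r \<longrightarrow>
       forces_code w a \<in> set_decode l \<and> forces_code w b \<in> set_decode r"
    and left_Just: "\<forall>w<B. \<forall>v<B. \<forall>t<B. \<forall>a<B. forces_code w (bin_code 6 t a) \<in> set_decode l \<longrightarrow>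
       rel_code w v \<in> set_decode l \<longrightarrow> forces_code v a \<in> set_decode l"
    and right_Just: "\<forall>w<B. \<forall>t<B. \<forall>a<B. forces_code w (bin_code 6 t a) \<in> set_decode r \<longrightarrow>
       evid_code w t a \<in> set_decode l \<longrightarrow>
       (\<exists>v<B. rel_code w v \<in> set_decode l \<and> forces_code v a \<in> set_decode r)"
    and left_Just_Evid: "\<forall>w<B. \<forall>t<B. \<forall>a<B. forces_code w (bin_code 6 t a) \<in> set_decode l \<longrightarrow>
       evid_code w t a \<in> set_decode l"
    and Evid_Plus_right: "\<forall>w<B. \<forall>s<B. \<forall>t<B. \<forall>a<B. evid_code w t a \<in> set_decode l \<longrightarrow>
       bin_code 3 s t \<in> set_decode ts \<longrightarrow> evid_code w (bin_code 3 s t) a \<in> set_decode l"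
    and Evid_Plus_left: "\<forall>w<B. \<forall>s<B. \<forall>t<B. \<forall>a<B. evid_code w t a \<in> set_decode l \<longrightarrow>
       bin_code 3 t s \<in> set_decode ts \<longrightarrow> evid_code w (bin_code 3 t s) a \<in> set_decode l"
    and Evid_App: "\<forall>w<B. \<forall>s<B. \<forall>t<B. \<forall>a<B. \<forall>b<B. evid_code w s (bin_code 5 a b) \<in> set_decode l \<longrightarrow>
       evid_code w t a \<in> set_decode l \<longrightarrow> bin_code 2 s t \<in> set_decode ts \<longrightarrow>
       evid_code w (bin_code 2 s t) b \<in> set_decode l"
    and Evid_const_Forces: "\<forall>w<B. \<forall>a<B. \<forall>c<B. \<forall>f<B. forces_code w a \<in> set_decode r \<longrightarrow>
       bin_code 6 (prod_encode (1, c)) f \<in> set_decode cs \<longrightarrow>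
       evid_code w (prod_encode (1, c)) f \<in> set_decode l"
    and Evid_const_Evid: "\<forall>w<B. \<forall>t<B. \<forall>a<B. \<forall>c<B. \<forall>f<B. evid_code w t a \<in> set_decode r \<longrightarrow>
       bin_code 6 (prod_encode (1, c)) f \<in> set_decode cs \<longrightarrow>
       evid_code w (prod_encode (1, c)) f \<in> set_decode l"
    and terms_Forces: "\<forall>w<B. \<forall>t<B. \<forall>a<B. forces_code w (bin_code 6 t a) \<in> set_decode r \<longrightarrow> t \<in> set_decode ts"
    and terms_Evid: "\<forall>w<B. \<forall>t<B. \<forall>a<B. evid_code w t a \<in> set_decode r \<longrightarrow> t \<in> set_decode ts"
    and terms_Plus: "\<forall>s<B. \<forall>t<B. bin_code 3 s t \<in> set_decode ts \<longrightarrow> s \<in> set_decode ts \<and> t \<in> set_decode ts"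
    and terms_App: "\<forall>s<B. \<forall>t<B. bin_code 2 s t \<in> set_decode ts \<longrightarrow> s \<in> set_decode ts \<and> t \<in> set_decode ts"

text \<open>The instance code \<open>x\<close> plays the role of \<open>N\<close>. Inclusions
  suffice for the three parts of the instance, because \<open>hintikka.not_derivable\<close>
  tolerates larger sets.\<close>

definition refuted_code :: "nat \<Rightarrow> bool" where
  "refuted_code x \<longleftrightarrow> (\<exists>c < Suc x. \<exists>g < Suc x. \<exists>d < Suc x. x = prod_encode (c, prod_encode (g, d)) \<and>
    (\<exists>cs < 2 ^ bound x. \<exists>ts < 2 ^ bound x.
     \<exists>l < 2 ^ item_bound (bound x). \<exists>r < 2 ^ item_bound (bound x).
       list_subset c cs \<and> list_subset g l \<and> list_subset d r \<and> hintikka_code (bound x) cs ts l r))"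

lemma recursive_pred_refuted_code: "recursive_pred (Suc 0) (\<lambda>xs. refuted_code (hd xs))"
  unfolding refuted_code_def hintikka_code_def item_bound_def by (intro rec_intros)

section \<open>Passage between saturated sets and their bit codes\<close>

lemma fm_code_eq_simps:
  "fm_code A = prod_encode (0, n) \<longleftrightarrow> A = Prop n"
  "fm_code A = prod_encode (1, 0) \<longleftrightarrow> A = Bot"
  "fm_code A = prod_encode (2, a) \<longleftrightarrow> (\<exists>A1. A = Neg A1 \<and> a = fm_code A1)"
  "fm_code A = bin_code 3 a b \<longleftrightarrow> (\<exists>A1 A2. A = Conj A1 A2 \<and> a = fm_code A1 \<and> b = fm_code A2)"
  "fm_code A = bin_code 4 a b \<longleftrightarrow> (\<exists>A1 A2. A = Disj A1 A2 \<and> a = fm_code A1 \<and> b = fm_code A2)"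
  "fm_code A = bin_code 5 a b \<longleftrightarrow> (\<exists>A1 A2. A = Imp A1 A2 \<and> a = fm_code A1 \<and> b = fm_code A2)"
  "fm_code A = bin_code 6 a b \<longleftrightarrow> (\<exists>t A1. A = Just t A1 \<and> a = tm_code t \<and> b = fm_code A1)"
  by (cases A; auto)+

lemma tm_code_eq_simps:
  "tm_code t = prod_encode (1, n) \<longleftrightarrow> t = JConst n"
  "tm_code t = bin_code 2 a b \<longleftrightarrow> (\<exists>t1 t2. t = App t1 t2 \<and> a = tm_code t1 \<and> b = tm_code t2)"
  "tm_code t = bin_code 3 a b \<longleftrightarrow> (\<exists>t1 t2. t = Plus t1 t2 \<and> a = tm_code t1 \<and> b = tm_code t2)"
  by (cases t; auto)+

lemma item_code_image_simps:
  "forces_code w a \<in> item_code ` X \<longleftrightarrow> (\<exists>A. a = fm_code A \<and> Forces w A \<in> X)"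
  "rel_code w v \<in> item_code ` X \<longleftrightarrow> Rel w v \<in> X"
  "evid_code w t a \<in> item_code ` X \<longleftrightarrow> (\<exists>s A. t = tm_code s \<and> a = fm_code A \<and> Evid w s A \<in> X)"
proof -
  have "item_code x = forces_code w a \<longleftrightarrow> (\<exists>A. a = fm_code A \<and> x = Forces w A)" for x
    by (cases x) auto
  then show "forces_code w a \<in> item_code ` X \<longleftrightarrow> (\<exists>A. a = fm_code A \<and> Forces w A \<in> X)"
    unfolding image_iff by metis
  have "item_code x = rel_code w v \<longleftrightarrow> x = Rel w v" for x
    by (cases x) auto
  then show "rel_code w v \<in> item_code ` X \<longleftrightarrow> Rel w v \<in> X"
    unfolding image_iff by metis
  have "item_code x = evid_code w t a \<longleftrightarrow> (\<exists>s A. t = tm_code s \<and> a = fm_code A \<and> x = Evid w s A)" for x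
    by (cases x) auto
  then show "evid_code w t a \<in> item_code ` X \<longleftrightarrow> (\<exists>s A. t = tm_code s \<and> a = fm_code A \<and> Evid w s A \<in> X)"
    unfolding image_iff by metis
qed

lemma hintikka_codeI:
  assumes "hintikka CS T L R"
    and cs: "set_decode cs = fm_code ` CS" and ts: "set_decode ts = tm_code ` T"
    and l: "set_decode l = item_code ` L" and r: "set_decode r = item_code ` R"
    and B: "\<forall>x \<in> L \<union> R. item_below B x"
  shows "hintikka_code B cs ts l r"
proof -
  interpret hintikka CS T L R by fact
  have cs_iff: "bin_code 6 (prod_encode (1, c)) f \<in> fm_code ` CS \<longleftrightarrow>
      (\<exists>F. f = fm_code F \<and> Just (JConst c) F \<in> CS)" for c f
  proof -
    have "fm_code A = bin_code 6 (prod_encode (1, c)) f \<longleftrightarrow>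
        (\<exists>F. f = fm_code F \<and> A = Just (JConst c) F)" for A
      using fm_code_eq_simps(7)[of A] tm_code_eq_simps(1) by metis
    then show ?thesis unfolding image_iff by metis
  qed
  have plus_iff: "bin_code 3 a b \<in> tm_code ` T \<longleftrightarrow>
      (\<exists>s t. a = tm_code s \<and> b = tm_code t \<and> Plus s t \<in> T)" for a b
    unfolding image_iff using tm_code_eq_simps(3) by metis
  have app_iff: "bin_code 2 a b \<in> tm_code ` T \<longleftrightarrow>
      (\<exists>s t. a = tm_code s \<and> b = tm_code t \<and> App s t \<in> T)" for a b
    unfolding image_iff using tm_code_eq_simps(2) by metis
  have fm: "prod_encode (i, a) = fm_code A \<longleftrightarrow> fm_code A = prod_encode (i, a)" for i a A by auto
  have tm: "prod_encode (i, a) = tm_code A \<longleftrightarrow> tm_code A = prod_encode (i, a)" for i a A by auto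
  \<comment> \<open>The coded condition also bounds the witness label; the bound comes from the
    relational atom in \<open>L\<close>.\<close>
  have right_Just': "\<exists>v < B. Rel w v \<in> L \<and> Forces v A \<in> R"
    if JE: "Forces w (Just t A) \<in> R" "Evid w t A \<in> L" for w t A
  proof -
    obtain v where "Rel w v \<in> L \<and> Forces v A \<in> R" using right_Just[OF JE] by blast
    moreover from this have "item_below B (Rel w v)" using B by blast
    ultimately show ?thesis by auto
  qed
  note code_simps = cs ts l r item_code_image_simps fm tm fm_code_eq_simps tm_code_eq_simps
    cs_iff plus_iff app_iff
  show ?thesis unfolding hintikka_code_def code_simps
    apply (intro conjI)
    subgoal using consistent_Prop by blast
    subgoal using consistent_Bot by blast
    subgoal using consistent_Rel by blast
    subgoal using consistent_Evid by (auto simp: fm_code_eq_iff tm_code_eq_iff)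
    subgoal using left_Neg by blast
    subgoal using right_Neg by blast
    subgoal using left_Conj by blast
    subgoal using right_Conj by blast
    subgoal using left_Disj by blast
    subgoal using right_Disj by blast
    subgoal using left_Imp by blast
    subgoal using right_Imp by blast
    subgoal using left_Just by blast
    subgoal using right_Just' by (auto simp: fm_code_eq_iff tm_code_eq_iff)
    subgoal using left_Just_Evid by blast
    subgoal using Evid_Plus_right by (auto simp: fm_code_eq_iff tm_code_eq_iff)
    subgoal using Evid_Plus_left by (auto simp: fm_code_eq_iff tm_code_eq_iff)
    subgoal using Evid_App by (auto simp: fm_code_eq_iff tm_code_eq_iff)
    subgoal using Evid_const_Forces by blast
    subgoal using Evid_const_Evid by blast
    subgoal using terms_Forces by blast
    subgoal using terms_Evid by blast
    subgoal using terms_Plus by blast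
    subgoal using terms_App by blast
    done
qed

lemma bin_code_lessD: "bin_code i a b < n \<Longrightarrow> a < n \<and> b < n"
  by (meson prod_encode_lessD)

text \<open>Bits that code no object are ignored by the comprehensions. Restriction to
  \<open>B\<close> preserves closure: components of bounded objects are bounded, and compound or
  constant terms in new evidence come from the bounded sets of terms and formulas.\<close>

lemma hintikka_codeD:
  assumes "hintikka_code B cs ts l r"
  shows "hintikka {F. fm_code F < B \<and> fm_code F \<in> set_decode cs}
    {t. tm_code t < B \<and> tm_code t \<in> set_decode ts}
    {x. item_below B x \<and> item_code x \<in> set_decode l}
    {x. item_below B x \<and> item_code x \<in> set_decode r}"
proof -
  interpret hintikka_code B cs ts l r by fact
  show ?thesis
    apply unfold_locales
    subgoal using consistent_Prop by (auto dest: prod_encode_lessD)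
    subgoal using consistent_Bot by (auto dest: prod_encode_lessD)
    subgoal using consistent_Rel by (auto dest: prod_encode_lessD)
    subgoal using consistent_Evid by (auto dest: prod_encode_lessD)
    subgoal using left_Neg by (auto dest: prod_encode_lessD)
    subgoal using right_Neg by (auto dest: prod_encode_lessD)
    subgoal using left_Conj by (auto dest!: bin_code_lessD dest: prod_encode_lessD)
    subgoal using right_Conj by (auto dest!: bin_code_lessD dest: prod_encode_lessD)
    subgoal using left_Disj by (auto dest!: bin_code_lessD dest: prod_encode_lessD)
    subgoal using right_Disj by (auto dest!: bin_code_lessD dest: prod_encode_lessD)
    subgoal using left_Imp by (auto dest!: bin_code_lessD dest: prod_encode_lessD)
    subgoal using right_Imp by (auto dest!: bin_code_lessD dest: prod_encode_lessD)
    subgoal using left_Just by (auto dest!: bin_code_lessD dest: prod_encode_lessD)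
    subgoal using right_Just by (auto dest!: bin_code_lessD) blast
    subgoal using left_Just_Evid by (auto dest!: bin_code_lessD dest: prod_encode_lessD)
    subgoal using Evid_Plus_right by clarsimp (frule bin_code_lessD, auto dest!: bin_code_lessD)
    subgoal using Evid_Plus_left by clarsimp (frule bin_code_lessD, auto dest!: bin_code_lessD)
    subgoal using Evid_App by clarsimp (frule bin_code_lessD, auto dest!: bin_code_lessD)
    subgoal using Evid_const_Forces by (auto dest!: bin_code_lessD dest: prod_encode_lessD)
    subgoal using Evid_const_Evid by (auto dest!: bin_code_lessD dest: prod_encode_lessD)
    subgoal using terms_Forces by (auto dest!: bin_code_lessD dest: prod_encode_lessD)
    subgoal using terms_Evid by (auto dest!: bin_code_lessD dest: prod_encode_lessD)
    subgoal using terms_Plus by (auto dest!: bin_code_lessD dest: prod_encode_lessD)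
    subgoal using terms_App by (auto dest!: bin_code_lessD dest: prod_encode_lessD)
    done
qed

lemma member_le_list_encode: "x \<in> set xs \<Longrightarrow> x \<le> list_encode xs"
proof (induction xs)
  case (Cons y ys)
  then show ?case
    using le_prod_encode_1[of y "list_encode ys"] le_prod_encode_2[of "list_encode ys" y] by auto
qed simp

text \<open>A found code decodes to a saturated pair over a superset of \<open>CS\<close>, which
  still refutes the sequent. Conversely, the pair built from an underivable sequent is small enough
  for its bit sets to lie within the quantifier bounds.\<close>

lemma refuted_code_iff:
  assumes "finite CS"
  shows "refuted_code (instance_code (CS, \<Gamma>, \<Delta>)) \<longleftrightarrow> \<not> G3J CS \<Gamma> \<Delta>"
proof -
  define c g d where "c = fmset_code CS" and "g = mset_code \<Gamma>" and "d = mset_code \<Delta>"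
  define x where "x = instance_code (CS, \<Gamma>, \<Delta>)"
  have x: "x = prod_encode (c, prod_encode (g, d))"
    by (simp add: x_def c_def g_def d_def instance_code_def sequent_code_def)
  then have le: "c \<le> x" "g \<le> x" "d \<le> x"
    using prod_encode_le_conjD[of c "prod_encode (g, d)" x] prod_encode_le_conjD[of g d x] by auto
  have c_iff: "list_subset c m \<longleftrightarrow> fm_code ` CS \<subseteq> set_decode m" for m
    using assms by (simp add: c_def fmset_code_def list_subset_iff)
  have g_iff: "list_subset g m \<longleftrightarrow> item_code ` set_mset \<Gamma> \<subseteq> set_decode m"
    and d_iff: "list_subset d m \<longleftrightarrow> item_code ` set_mset \<Delta> \<subseteq> set_decode m" for m
    by (simp_all add: g_def d_def mset_code_def list_subset_iff)
  have CS: "\<forall>F \<in> CS. fm_code F \<le> x"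
  proof
    fix F assume "F \<in> CS"
    then have "fm_code F \<le> c"
      unfolding c_def fmset_code_def using assms by (intro member_le_list_encode) simp
    then show "fm_code F \<le> x" using le by simp
  qed
  have items: "\<forall>y \<in> set_mset \<Gamma> \<union> set_mset \<Delta>. item_code y \<le> x"
  proof
    fix y assume "y \<in> set_mset \<Gamma> \<union> set_mset \<Delta>"
    then have "item_code y \<le> g \<or> item_code y \<le> d"
      unfolding g_def d_def mset_code_def by (auto intro: member_le_list_encode)
    then show "item_code y \<le> x" using le by auto
  qed
  let ?B = "bound x"
  have "refuted_code x \<longleftrightarrow> (\<exists>cs < 2 ^ ?B. \<exists>ts < 2 ^ ?B. \<exists>l < 2 ^ item_bound ?B. \<exists>r < 2 ^ item_bound ?B.
       list_subset c cs \<and> list_subset g l \<and> list_subset d r \<and> hintikka_code ?B cs ts l r)"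
    (is "_ \<longleftrightarrow> ?rhs")
  proof
    assume "refuted_code x"
    then show ?rhs unfolding refuted_code_def using x by auto
  next
    assume ?rhs
    then show "refuted_code x" unfolding refuted_code_def using x le less_Suc_eq_le by blast
  qed
  also have "\<dots> \<longleftrightarrow> \<not> G3J CS \<Gamma> \<Delta>"
  proof
    assume ?rhs
    then obtain cs ts l r where sub: "list_subset c cs" "list_subset g l" "list_subset d r"
      and H: "hintikka_code ?B cs ts l r" by blast
    have below: "item_below ?B y" if "y \<in> set_mset \<Gamma> \<union> set_mset \<Delta>" for y
      using that items item_code_leD admissible_below by blast
    show "\<not> G3J CS \<Gamma> \<Delta>"
    proof (rule hintikka.not_derivable[OF hintikka_codeD[OF H]])
      show "CS \<subseteq> {F. fm_code F < ?B \<and> fm_code F \<in> set_decode cs}"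
        using sub(1) CS less_bound unfolding c_iff by blast
      show "set_mset \<Gamma> \<subseteq> {x. item_below ?B x \<and> item_code x \<in> set_decode l}"
        using sub(2) below unfolding g_iff by blast
      show "set_mset \<Delta> \<subseteq> {x. item_below ?B x \<and> item_code x \<in> set_decode r}"
        using sub(3) below unfolding d_iff by blast
    qed
  next
    assume "\<not> G3J CS \<Gamma> \<Delta>"
    then obtain L R where H: "hintikka CS {t. tm_code t < ?B} L R"
      and sub: "set_mset \<Gamma> \<subseteq> L" "set_mset \<Delta> \<subseteq> R" and below: "\<forall>x \<in> L \<union> R. item_below ?B x"
      using underivable_hintikka[OF _ CS items] by blast
    let ?cs = "fm_code ` CS" and ?ts = "tm_code ` {t. tm_code t < ?B}"
      and ?l = "item_code ` L" and ?r = "item_code ` R"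
    have bounds: "?cs \<subseteq> {..<?B}" "?ts \<subseteq> {..<?B}"
      "?l \<subseteq> {..<item_bound ?B}" "?r \<subseteq> {..<item_bound ?B}"
      using CS less_bound below item_code_less by auto
    note fin = bounds[THEN finite_subset[OF _ finite_lessThan], THEN set_encode_inverse]
    note less = bounds[THEN set_encode_less]
    have "hintikka_code ?B (set_encode ?cs) (set_encode ?ts) (set_encode ?l) (set_encode ?r)"
      by (rule hintikka_codeI[OF H fin below])
    moreover have "list_subset c (set_encode ?cs)" "list_subset g (set_encode ?l)"
      "list_subset d (set_encode ?r)"
      unfolding c_iff g_iff d_iff fin using sub by blast+
    ultimately show ?rhs using less by blast
  qed
  finally show ?thesis unfolding x_def .
qed

theorem theorem9p1:
  shows "decidable_problem instance_code
    {(CS, S). finite CS \<and> constant_specification CS}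
    (\<lambda>(CS, \<Gamma>, \<Delta>). G3J CS \<Gamma> \<Delta>)"
  unfolding decidable_problem_def
proof (intro exI conjI ballI)
  \<comment> \<open>\<open>refuted_code\<close> recognizes the no-instances, so its complement
    decides derivability.\<close>
  show "recursive_fn 1 (\<lambda>xs. if \<not> refuted_code (hd xs) then 1 else 0)"
    using recursive_pred_not[OF recursive_pred_refuted_code] unfolding recursive_pred_def by simp
qed (auto simp: refuted_code_iff)

end
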